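(* Bounded hermitian operators on $\mathcal{Z}_0^{(0,1)}$ are trivial, i.e. of the form $\mathcal{G}f(z)=\alpha f(z)$ with $\alpha\in\mathbb{R}$. The function $f(z)=z^2$ is not in the domain of $\mathcal{G}$ in the elliptic, hyperbolic and parabolic cases. Moreover, the point spectrum of $\mathcal{G}$ is a singleton for $\mathcal{G}f(z)=\alpha f(z)$ and empty in the remaining (elliptic, hyperbolic and parabolic) cases.
   Context: $\triangle=\{z\in\mathbb{C}:|z|<1\}$ is the open unit disc. The Zygmund space $\mathcal{Z}$ is the set of all analytic functions $f$ on $\triangle$ that extend continuously to the boundary and satisfy $\sup_{|z|<1}(1-|z|^2)|f''(z)|<\infty$, with norm $\|f\|_{\mathcal{Z}}=|f(0)|+|f'(0)|+\sup_{|z|<1}(1-|z|^2)|f''(z)|$. The little Zygmund space is $\mathcal{Z}_0=\{f\in\mathcal{Z}:\lim_{|z|\to1^-}(1-|z|^2)|f''(z)|=0\}$, and $\mathcal{Z}_0^{(0,1)}=\{f\in\mathcal{Z}_0: f(0)=f'(0)=0\}$ with the inherited norm. Hermitian operators (possibly unbounded) on $\mathcal{Z}_0^{(0,1)}$ are the generators $\mathcal{G}f=-i\,\frac{d}{dt}T_tf\big|_{t=0}$ of strongly continuous one-parameter groups $\{T_t\}_{t\in\mathbb{R}}$ of surjective linear isometries of $\mathcal{Z}_0^{(0,1)}$. Such groups are written $T_tf(z)=e^{i\alpha t}\int_0^z[f'(\sigma_t(\xi))-f'(\sigma_t(0))]\,d\xi$, with $\alpha\in\mathbb{R}$ and $\{\sigma_t\}_{t\in\mathbb{R}}$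 a continuous one-parameter group of automorphisms of $\triangle$. The group $\{\sigma_t\}$ is either trivial or elliptic (a single common fixed point in $\triangle$ and another in the interior of its complement), hyperbolic (two distinct common fixed points on the boundary of $\triangle$) or parabolic (a single common fixed point, on the boundary of $\triangle$). Correspondingly, $\mathcal{G}$ is given by one of the following forms, with $\alpha\in\mathbb{R}$: (1) trivial: $\mathcal{G}f(z)=\alpha f(z)$; (2) elliptic: $\mathcal{G}f(z)=\alpha f(z)-c\,\frac{(\overline{\tau}z-1)(z-\tau)}{1-|\tau|^2}f'(z)$, with $c\in\mathbb{R}\setminus\{0\}$ and $\tau\in\mathbb{C}$, $|\tau|<1$; (3) hyperbolic: $\mathcal{G}f(z)=\alpha f(z)+\frac{i\varphi}{\beta_0-\beta_1}(z-\beta_0)(z-\beta_1)f'(z)$, with $\varphi>0$, $|\beta_0|=|\beta_1|=1$ and $\beta_0\neq\beta_1$; (4) parabolic: $\mathcal{G}f(z)=\alpha f(z)+c\,\overline{\gamma}(z-\gamma)^2f'(z)$, with $c\in\mathbb{R}\setminus\{0\}$ and $|\gamma|=1$.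
   Formalization: In the elliptic case the domain and point-spectrum claims assume τ ≠ 0 (for τ = 0, z² is an eigenvector). These claims concern formulas (2)–(4) on their maximal domain; the generators of the displayed groups differ from these formulas and have z² in their domain. *)

theory Defs
  imports "HOL-Complex_Analysis.Complex_Analysis"
begin

section \<open>The Zygmund spaces\<close>

text \<open>
  Functions on the open unit disc are represented by total functions that vanish outside
  \<open>ball 0 1\<close>.  This makes equality of functions on the disc plain equality and is compatible with
  the pointwise vector space operations; the value 0 on the unit circle is not the boundary value,
  which is given by the continuous extension \<open>h\<close>.
\<close>

definition zygmund_weight :: "(complex \<Rightarrow> complex) \<Rightarrow> complex \<Rightarrow> real" where
  "zygmund_weight f z = (1 - (cmod z)\<^sup>2) * cmod ((deriv ^^ 2) f z)"

definition zygmund :: "(complex \<Rightarrow> complex) set" where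
  "zygmund = {f. (\<forall>z. z \<notin> ball 0 1 \<longrightarrow> f z = 0) \<and> f holomorphic_on ball 0 1 \<and>
     (\<exists>h. continuous_on (cball 0 1) h \<and> (\<forall>z\<in>ball 0 1. h z = f z)) \<and>
     bdd_above (zygmund_weight f ` ball 0 1)}"

definition zygmund_norm :: "(complex \<Rightarrow> complex) \<Rightarrow> real" where
  "zygmund_norm f = cmod (f 0) + cmod (deriv f 0) + (SUP z\<in>ball 0 1. zygmund_weight f z)"

definition little_zygmund :: "(complex \<Rightarrow> complex) set" where
  "little_zygmund =
     {f \<in> zygmund. (zygmund_weight f \<longlongrightarrow> 0) (filtercomap cmod (at_left 1))}"

definition little_zygmund00 :: "(complex \<Rightarrow> complex) set" where
  "little_zygmund00 = {f \<in> little_zygmund. f 0 = 0 \<and> deriv f 0 = 0}"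


section \<open>Hermitian operators\<close>

text \<open>
  A possibly unbounded operator on \<open>little_zygmund00\<close> is represented by its graph;
  its domain is the relational \<open>Domain\<close>.
\<close>

type_synonym zoperator = "((complex \<Rightarrow> complex) \<times> (complex \<Rightarrow> complex)) set"

definition surj_lin_isometry :: "((complex \<Rightarrow> complex) \<Rightarrow> (complex \<Rightarrow> complex)) \<Rightarrow> bool" where
  "surj_lin_isometry T \<longleftrightarrow>
     T ` little_zygmund00 = little_zygmund00 \<and>
     (\<forall>f\<in>little_zygmund00. \<forall>g\<in>little_zygmund00. \<forall>a b.
        T (\<lambda>z. a * f z + b * g z) = (\<lambda>z. a * T f z + b * T g z)) \<and>
     (\<forall>f\<in>little_zygmund00. zygmund_norm (T f) = zygmund_norm f)"

definition isometry_group :: "(real \<Rightarrow> (complex \<Rightarrow> complex) \<Rightarrow> (complex \<Rightarrow> complex)) \<Rightarrow> bool" where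
  "isometry_group T \<longleftrightarrow>
     (\<forall>t. surj_lin_isometry (T t)) \<and>
     (\<forall>f\<in>little_zygmund00. T 0 f = f) \<and>
     (\<forall>s t. \<forall>f\<in>little_zygmund00. T (s + t) f = T s (T t f)) \<and>
     (\<forall>f\<in>little_zygmund00. \<forall>s.
        ((\<lambda>t. zygmund_norm (\<lambda>z. T t f z - T s f z)) \<longlongrightarrow> 0) (at s))"

definition group_generator ::
    "(real \<Rightarrow> (complex \<Rightarrow> complex) \<Rightarrow> (complex \<Rightarrow> complex)) \<Rightarrow> zoperator" where
  "group_generator T = {(f, g). f \<in> little_zygmund00 \<and> g \<in> little_zygmund00 \<and>
     ((\<lambda>t. zygmund_norm (\<lambda>z. - \<i> * ((T t f z - f z) / of_real t) - g z)) \<longlongrightarrow> 0) (at 0)}"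

definition hermitian_op :: "zoperator \<Rightarrow> bool" where
  "hermitian_op G \<longleftrightarrow> (\<exists>T. isometry_group T \<and> G = group_generator T)"

definition bounded_op :: "zoperator \<Rightarrow> bool" where
  "bounded_op G \<longleftrightarrow> Domain G = little_zygmund00 \<and>
     (\<exists>C. \<forall>(f, g)\<in>G. zygmund_norm g \<le> C * zygmund_norm f)"

definition point_spectrum :: "zoperator \<Rightarrow> complex set" where
  "point_spectrum G = {\<mu>. \<exists>f. f \<noteq> (\<lambda>_. 0) \<and> (f, \<lambda>z. \<mu> * f z) \<in> G}"


section \<open>The explicit forms\<close>

text \<open>
  The differential expression \<open>\<alpha> f + p f'\<close> on its natural (maximal) domain: all \<open>f\<close> in the space
  that are mapped back into the space.
\<close>

definition diff_op :: "real \<Rightarrow> (complex \<Rightarrow> complex) \<Rightarrow> zoperator" where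
  "diff_op \<alpha> p = {(f, g). f \<in> little_zygmund00 \<and> g \<in> little_zygmund00 \<and>
     (\<forall>z\<in>ball 0 1. g z = of_real \<alpha> * f z + p z * deriv f z)}"

definition trivial_op :: "real \<Rightarrow> zoperator" where
  "trivial_op \<alpha> = {(f, \<lambda>z. of_real \<alpha> * f z) |f. f \<in> little_zygmund00}"

definition elliptic_op :: "real \<Rightarrow> real \<Rightarrow> complex \<Rightarrow> zoperator" where
  "elliptic_op \<alpha> c \<tau> = diff_op \<alpha>
     (\<lambda>z. - (of_real c * ((cnj \<tau> * z - 1) * (z - \<tau>) / of_real (1 - (cmod \<tau>)\<^sup>2))))"

definition hyperbolic_op :: "real \<Rightarrow> real \<Rightarrow> complex \<Rightarrow> complex \<Rightarrow> zoperator" where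
  "hyperbolic_op \<alpha> \<phi> \<beta>\<^sub>0 \<beta>\<^sub>1 = diff_op \<alpha>
     (\<lambda>z. \<i> * of_real \<phi> / (\<beta>\<^sub>0 - \<beta>\<^sub>1) * (z - \<beta>\<^sub>0) * (z - \<beta>\<^sub>1))"

definition parabolic_op :: "real \<Rightarrow> real \<Rightarrow> complex \<Rightarrow> zoperator" where
  "parabolic_op \<alpha> c \<gamma> = diff_op \<alpha> (\<lambda>z. of_real c * cnj \<gamma> * (z - \<gamma>)\<^sup>2)"

definition explicit_form :: "zoperator \<Rightarrow> bool" where
  "explicit_form G \<longleftrightarrow>
     (\<exists>\<alpha>. G = trivial_op \<alpha>) \<or>
     (\<exists>\<alpha> c \<tau>. c \<noteq> 0 \<and> cmod \<tau> < 1 \<and> G = elliptic_op \<alpha> c \<tau>) \<or>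
     (\<exists>\<alpha> \<phi> \<beta>\<^sub>0 \<beta>\<^sub>1. \<phi> > 0 \<and> cmod \<beta>\<^sub>0 = 1 \<and> cmod \<beta>\<^sub>1 = 1 \<and> \<beta>\<^sub>0 \<noteq> \<beta>\<^sub>1 \<and> G = hyperbolic_op \<alpha> \<phi> \<beta>\<^sub>0 \<beta>\<^sub>1) \<or>
     (\<exists>\<alpha> c \<gamma>. c \<noteq> 0 \<and> cmod \<gamma> = 1 \<and> G = parabolic_op \<alpha> c \<gamma>)"

definition disc_square :: "complex \<Rightarrow> complex" where
  "disc_square z = (if z \<in> ball 0 1 then z\<^sup>2 else 0)"


section \<open>The elliptic form centred at the origin\<close>

text \<open>
  For \<open>\<tau> = 0\<close> the second fixed point \<open>1 / cnj \<tau>\<close> of the elliptic group is not a point of the complex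
  plane.  In that case the square function is in the domain and is an eigenvector, so the assertions
  about the elliptic form are about \<open>\<tau> \<noteq> 0\<close>.
\<close>

lemma deriv_disc_square:
  assumes "z \<in> ball 0 1"
  shows "deriv disc_square z = 2 * z"
proof (rule DERIV_imp_deriv)
  have "((\<lambda>z. z\<^sup>2) has_field_derivative 2 * z) (at z)"
    by (auto intro!: derivative_eq_intros)
  then show "(disc_square has_field_derivative 2 * z) (at z)"
    by (rule has_field_derivative_transform_within_open[of _ _ _ "ball 0 1"])
       (use assms in \<open>auto simp: disc_square_def\<close>)
qed

lemma deriv2_disc_square:
  assumes "z \<in> ball 0 1"
  shows "(deriv ^^ 2) disc_square z = 2"
proof -
  have "deriv (deriv disc_square) z = 2"
  proof (rule DERIV_imp_deriv)
    have "((\<lambda>z. 2 * z) has_field_derivative 2) (at z)"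
      by (auto intro!: derivative_eq_intros)
    then show "(deriv disc_square has_field_derivative 2) (at z)"
      by (rule has_field_derivative_transform_within_open[of _ _ _ "ball 0 1"])
         (use assms in \<open>auto simp: deriv_disc_square\<close>)
  qed
  then show ?thesis by (simp add: numeral_2_eq_2)
qed

lemma zygmund_weight_mult_disc_square:
  assumes "z \<in> ball 0 1"
  shows "zygmund_weight (\<lambda>z. a * disc_square z) z = 2 * cmod a * (1 - (cmod z)\<^sup>2)"
proof -
  have hol: "disc_square holomorphic_on ball 0 1"
    by (rule holomorphic_transform[of "\<lambda>z. z\<^sup>2"]) (auto intro!: holomorphic_intros simp: disc_square_def)
  have d1: "deriv (\<lambda>z. a * disc_square z) w = a * deriv disc_square w" if "w \<in> ball 0 1" for w
    using that hol by (intro deriv_cmult) (auto simp: holomorphic_on_imp_differentiable_at)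
  have "deriv (deriv (\<lambda>z. a * disc_square z)) z = 2 * a"
  proof (rule DERIV_imp_deriv)
    have "((\<lambda>z. a * (2 * z)) has_field_derivative 2 * a) (at z)"
      by (auto intro!: derivative_eq_intros)
    then show "(deriv (\<lambda>z. a * disc_square z) has_field_derivative 2 * a) (at z)"
      by (rule has_field_derivative_transform_within_open[of _ _ _ "ball 0 1"])
         (use assms d1 deriv_disc_square in auto)
  qed
  then show ?thesis
    by (simp add: zygmund_weight_def numeral_2_eq_2 norm_mult)
qed

lemma mult_disc_square_in: "(\<lambda>z. a * disc_square z) \<in> little_zygmund00"
proof -
  let ?f = "\<lambda>z. a * disc_square z"
  have hol: "?f holomorphic_on ball 0 1"
    by (rule holomorphic_transform[of "\<lambda>z. a * z\<^sup>2"])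
       (auto intro!: holomorphic_intros simp: disc_square_def)
  have "bdd_above (zygmund_weight ?f ` ball 0 1)"
    by (rule bdd_aboveI2[of _ _ "2 * cmod a"])
       (simp add: zygmund_weight_mult_disc_square mult_left_le)
  moreover have "\<exists>h. continuous_on (cball 0 1) h \<and> (\<forall>z\<in>ball 0 1. h z = ?f z)"
    by (rule exI[of _ "\<lambda>z. a * z\<^sup>2"]) (auto intro!: continuous_intros simp: disc_square_def)
  ultimately have "?f \<in> zygmund"
    using hol by (auto simp: zygmund_def disc_square_def)
  moreover have "(zygmund_weight ?f \<longlongrightarrow> 0) (filtercomap cmod (at_left 1))"
  proof -
    have "((\<lambda>r. 2 * cmod a * (1 - r\<^sup>2)) \<longlongrightarrow> 2 * cmod a * (1 - 1\<^sup>2)) (at_left (1::real))"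
      by (intro tendsto_intros)
    then have "((\<lambda>z. 2 * cmod a * (1 - (cmod z)\<^sup>2)) \<longlongrightarrow> 0) (filtercomap cmod (at_left 1))"
      using filterlim_compose[OF _ filterlim_filtercomap, of "\<lambda>r. 2 * cmod a * (1 - r\<^sup>2)" "nhds 0"]
      by simp
    moreover have "\<forall>\<^sub>F z in filtercomap cmod (at_left 1).
        2 * cmod a * (1 - (cmod z)\<^sup>2) = zygmund_weight ?f z"
      unfolding eventually_filtercomap
      by (rule exI[of _ "\<lambda>r. r < 1"])
         (auto simp: zygmund_weight_mult_disc_square eventually_at_filter)
    ultimately show ?thesis
      by (rule Lim_transform_eventually)
  qed
  moreover have "deriv ?f 0 = 0"
  proof -
    have "((\<lambda>z. a * z\<^sup>2) has_field_derivative 0) (at 0)"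
      by (auto intro!: derivative_eq_intros)
    then have "(?f has_field_derivative 0) (at 0)"
      by (rule has_field_derivative_transform_within_open[of _ _ _ "ball 0 1"])
         (auto simp: disc_square_def)
    then show ?thesis by (rule DERIV_imp_deriv)
  qed
  ultimately show ?thesis
    by (simp add: little_zygmund00_def little_zygmund_def disc_square_def)
qed

lemma elliptic_op_0_eigenvector:
  "(disc_square, \<lambda>z. of_real (\<alpha> + 2 * c) * disc_square z) \<in> elliptic_op \<alpha> c 0"
  using mult_disc_square_in[of 1] mult_disc_square_in[of "of_real (\<alpha> + 2 * c)"]
  by (auto simp: elliptic_op_def diff_op_def deriv_disc_square)
     (auto simp: disc_square_def power2_eq_square algebra_simps)

end

theory Submission
  imports Defs
begin

text \<open>
  The norm of \<open>f\<close> is the maximum of \<open>(1 - |z|\<^sup>2) |f''(z)|\<close>. If this maximum is attained at \<open>a\<close>, then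
  evaluating \<open>f''\<close> at \<open>a\<close> gives a support functional of \<open>f\<close>, so for a generator \<open>G\<close> of isometries the
  quotient \<open>(G f)''(a) / f''(a)\<close> is real. The functions with \<open>f'' = 1 / (1 - cnj a z)\<^sup>2\<close> attain the
  maximum exactly at \<open>a\<close>, and nondegenerately, so every \<open>k\<close> whose \<open>k''\<close> has a double zero at \<open>a\<close> can be
  added with a small complex coefficient; hence \<open>(G k)''(a) = 0\<close>, which means
  \<open>(G f)'' = A f'' + B f'''\<close>. Boundedness on the monomials forces \<open>B = 0\<close>, and then \<open>A\<close> is real-valued and
  holomorphic, thus constant. In the explicit forms \<open>\<alpha> f + p f'\<close> the coefficient \<open>p\<close> does not vanish at
  the origin (except for the elliptic form with \<open>\<tau> = 0\<close>, which multiplies the monomials by unbounded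
  factors), while all functions of the space vanish there to second order; comparing orders at 0 gives
  the remaining claims.
\<close>

section \<open>The space\<close>

lemma higher_deriv_lincomb:
  fixes f g :: "complex \<Rightarrow> complex"
  assumes "f holomorphic_on S" "g holomorphic_on S" "open S" "z \<in> S"
  shows "(deriv ^^ n) (\<lambda>z. a * f z + b * g z) z = a * (deriv ^^ n) f z + b * (deriv ^^ n) g z"
proof -
  have "(deriv ^^ n) (\<lambda>z. a * f z + b * g z) z
      = (deriv ^^ n) (\<lambda>z. a * f z) z + (deriv ^^ n) (\<lambda>z. b * g z) z"
    by (rule higher_deriv_add[where S = S]) (use assms in \<open>auto intro!: holomorphic_intros\<close>)
  then show ?thesis
    using assms by (simp add: higher_deriv_cmult[where A = S])
qed

lemma little_zygmund00D:
  assumes "f \<in> little_zygmund00"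
  shows little_zygmund00_holomorphic: "f holomorphic_on ball 0 1"
    and little_zygmund00_outside: "z \<notin> ball 0 1 \<Longrightarrow> f z = 0"
    and little_zygmund00_bdd: "bdd_above (zygmund_weight f ` ball 0 1)"
    and little_zygmund00_0: "f 0 = 0"
    and little_zygmund00_deriv_0: "deriv f 0 = 0"
    and little_zygmund00_tendsto: "(zygmund_weight f \<longlongrightarrow> 0) (filtercomap cmod (at_left 1))"
  using assms by (auto simp: little_zygmund00_def little_zygmund_def zygmund_def)

lemma zygmund_weight_nonneg: "z \<in> ball 0 1 \<Longrightarrow> 0 \<le> zygmund_weight f z"
  by (simp add: zygmund_weight_def power_le_one)

lemma zygmund_norm_eq_Sup:
  "f \<in> little_zygmund00 \<Longrightarrow> zygmund_norm f = (SUP z\<in>ball 0 1. zygmund_weight f z)"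
  by (simp add: zygmund_norm_def little_zygmund00_0 little_zygmund00_deriv_0)

lemma zygmund_weight_le_norm:
  "f \<in> little_zygmund00 \<Longrightarrow> z \<in> ball 0 1 \<Longrightarrow> zygmund_weight f z \<le> zygmund_norm f"
  by (simp add: zygmund_norm_eq_Sup cSUP_upper little_zygmund00_bdd)

lemma zygmund_norm_le:
  assumes "f \<in> little_zygmund00" "\<And>z. z \<in> ball 0 1 \<Longrightarrow> zygmund_weight f z \<le> B"
  shows "zygmund_norm f \<le> B"
  using assms by (auto simp: zygmund_norm_eq_Sup intro!: cSUP_least)

lemma zygmund_norm_nonneg: "f \<in> little_zygmund00 \<Longrightarrow> 0 \<le> zygmund_norm f"
  using zygmund_weight_le_norm[of f 0] zygmund_weight_nonneg[of 0 f] by simp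

lemma zygmund_weight_lincomb_le:
  assumes "f holomorphic_on ball 0 1" "g holomorphic_on ball 0 1" "z \<in> ball 0 1"
  shows "zygmund_weight (\<lambda>z. a * f z + b * g z) z
           \<le> cmod a * zygmund_weight f z + cmod b * zygmund_weight g z"
proof -
  have "cmod (a * (deriv ^^ 2) f z + b * (deriv ^^ 2) g z)
      \<le> cmod a * cmod ((deriv ^^ 2) f z) + cmod b * cmod ((deriv ^^ 2) g z)"
    by (metis norm_triangle_ineq norm_mult)
  moreover have "0 \<le> 1 - (cmod z)\<^sup>2"
    using assms by (simp add: power_le_one)
  ultimately show ?thesis
    using higher_deriv_lincomb[OF assms(1,2) _ assms(3)]
    by (auto simp: zygmund_weight_def algebra_simps dest: mult_left_mono[where c = "1 - (cmod z)\<^sup>2"])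
qed

lemma eventually_in_disc: "\<forall>\<^sub>F z in filtercomap cmod (at_left 1). z \<in> ball 0 1"
  unfolding eventually_filtercomap
  by (rule exI[of _ "\<lambda>r. r < 1"]) (auto simp: eventually_at_filter)

lemma little_zygmund00_lincomb:
  assumes f: "f \<in> little_zygmund00" and g: "g \<in> little_zygmund00"
  shows "(\<lambda>z. a * f z + b * g z) \<in> little_zygmund00"
proof -
  let ?h = "\<lambda>z. a * f z + b * g z"
  note hol = little_zygmund00_holomorphic[OF f] little_zygmund00_holomorphic[OF g]
  have le: "zygmund_weight ?h z \<le> cmod a * zygmund_weight f z + cmod b * zygmund_weight g z"
    if "z \<in> ball 0 1" for z
    by (rule zygmund_weight_lincomb_le[OF hol that])
  have "bdd_above (zygmund_weight ?h ` ball 0 1)"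
  proof (rule bdd_aboveI2)
    fix z :: complex assume z: "z \<in> ball 0 1"
    show "zygmund_weight ?h z \<le> cmod a * zygmund_norm f + cmod b * zygmund_norm g"
      by (rule order_trans[OF le[OF z]])
         (intro add_mono mult_left_mono zygmund_weight_le_norm norm_ge_zero f g z)
  qed
  moreover have "\<exists>h. continuous_on (cball 0 1) h \<and> (\<forall>z\<in>ball 0 1. h z = ?h z)"
  proof -
    obtain h1 h2 where "continuous_on (cball 0 1) h1" "\<forall>z\<in>ball 0 1. h1 z = f z"
      "continuous_on (cball 0 1) h2" "\<forall>z\<in>ball 0 1. h2 z = g z"
      using f g by (auto simp: little_zygmund00_def little_zygmund_def zygmund_def)
    then show ?thesis
      by (intro exI[of _ "\<lambda>z. a * h1 z + b * h2 z"]) (auto intro!: continuous_intros)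
  qed
  moreover have "?h holomorphic_on ball 0 1"
    using hol by (intro holomorphic_intros)
  moreover have "(zygmund_weight ?h \<longlongrightarrow> 0) (filtercomap cmod (at_left 1))"
  proof (rule Lim_null_comparison)
    show "\<forall>\<^sub>F z in filtercomap cmod (at_left 1). norm (zygmund_weight ?h z)
        \<le> cmod a * zygmund_weight f z + cmod b * zygmund_weight g z"
      using eventually_in_disc
      by eventually_elim (use le zygmund_weight_nonneg[of _ ?h] in auto)
    show "((\<lambda>z. cmod a * zygmund_weight f z + cmod b * zygmund_weight g z) \<longlongrightarrow> 0)
        (filtercomap cmod (at_left 1))"
      using tendsto_add[OF tendsto_mult_left[OF little_zygmund00_tendsto[OF f], of "cmod a"]
          tendsto_mult_left[OF little_zygmund00_tendsto[OF g], of "cmod b"]] by simp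
  qed
  moreover have "deriv ?h 0 = 0"
    using higher_deriv_lincomb[OF hol, of 0 1 a b]
    by (simp add: little_zygmund00_deriv_0 f g)
  ultimately show ?thesis
    using f g by (simp add: little_zygmund00_def little_zygmund_def zygmund_def)
qed

lemma zygmund_norm_lincomb_le:
  assumes f: "f \<in> little_zygmund00" and g: "g \<in> little_zygmund00"
  shows "zygmund_norm (\<lambda>z. a * f z + b * g z) \<le> cmod a * zygmund_norm f + cmod b * zygmund_norm g"
proof (rule zygmund_norm_le[OF little_zygmund00_lincomb[OF f g]])
  fix z :: complex assume z: "z \<in> ball 0 1"
  show "zygmund_weight (\<lambda>z. a * f z + b * g z) z \<le> cmod a * zygmund_norm f + cmod b * zygmund_norm g"
    by (rule order_trans[OF zygmund_weight_lincomb_le[OF little_zygmund00_holomorphic[OF f]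
            little_zygmund00_holomorphic[OF g] z]])
       (intro add_mono mult_left_mono zygmund_weight_le_norm norm_ge_zero f g z)
qed

text \<open>An element of the space is determined by its second derivative: integrating twice over
  the convex disc leaves two constants, and the normalisation at 0 kills both.\<close>

lemma little_zygmund00_eq_zero:
  assumes f: "f \<in> little_zygmund00" and "\<And>z. z \<in> ball 0 1 \<Longrightarrow> (deriv ^^ 2) f z = 0"
  shows "f = (\<lambda>_. 0)"
proof -
  note hol = little_zygmund00_holomorphic[OF f]
  have D: "(f has_field_derivative deriv f z) (at z)"
    "(deriv f has_field_derivative (deriv ^^ 2) f z) (at z)" if "z \<in> ball 0 1" for z
    using that hol has_field_derivative_higher_deriv[OF hol _ that, of 1]
    by (auto simp: holomorphic_derivI numeral_2_eq_2)
  have "(deriv f has_field_derivative 0) (at z within ball 0 1)" if "z \<in> ball 0 1" for z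
    using D(2)[OF that] assms(2)[OF that] by (simp add: has_field_derivative_at_within)
  then obtain c where c: "\<forall>z\<in>ball 0 1. deriv f z = c"
    using has_field_derivative_zero_constant[OF convex_ball, where f = "deriv f"] by meson
  moreover have "c = 0"
    using c[rule_format, of 0] little_zygmund00_deriv_0[OF f] by simp
  ultimately have "(f has_field_derivative 0) (at z within ball 0 1)" if "z \<in> ball 0 1" for z
    using D(1)[OF that] that by (auto intro: has_field_derivative_at_within)
  then obtain d where d: "\<forall>z\<in>ball 0 1. f z = d"
    using has_field_derivative_zero_constant[OF convex_ball, where f = f] by meson
  moreover have "d = 0"
    using d[rule_format, of 0] little_zygmund00_0[OF f] by simp
  ultimately show ?thesis
    using little_zygmund00_outside[OF f] by fastforce
qed

section \<open>Construction of test functions\<close>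

text \<open>On the compact closed disc the second derivative of \<open>F\<close> is bounded by some
  \<open>M\<close>, so the weight is at most \<open>(1 - |z|^2) * M\<close>, which tends to 0 at the
  circle.\<close>

lemma restriction_in_little_zygmund00:
  fixes F :: "complex \<Rightarrow> complex"
  assumes hol: "F holomorphic_on ball 0 R" and R: "1 < R" and F: "F 0 = 0" "deriv F 0 = 0"
  defines "f \<equiv> \<lambda>z. if z \<in> ball 0 1 then F z else 0"
  shows "f \<in> little_zygmund00"
    and "z \<in> ball 0 1 \<Longrightarrow> (deriv ^^ n) f z = (deriv ^^ n) F z"
proof -
  have sub: "cball 0 1 \<subseteq> ball (0::complex) R"
    using R by auto
  have F1: "F holomorphic_on ball 0 1"
    using hol sub by (meson ball_subset_cball holomorphic_on_subset)
  then have f1: "f holomorphic_on ball 0 1"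
    by (rule holomorphic_transform) (simp add: f_def)
  show deriv_eq: "(deriv ^^ n) f z = (deriv ^^ n) F z" if "z \<in> ball 0 1" for n z
    by (rule higher_deriv_transform_within_open[OF f1 F1]) (use that in \<open>auto simp: f_def\<close>)
  have "continuous_on (cball 0 1) ((deriv ^^ 2) F)"
    by (rule holomorphic_on_imp_continuous_on, rule holomorphic_on_subset[OF _ sub])
       (intro holomorphic_higher_deriv hol open_ball)
  then have "bounded ((deriv ^^ 2) F ` cball 0 1)"
    by (intro compact_imp_bounded compact_continuous_image compact_cball)
  then obtain M where M: "\<And>z. z \<in> cball 0 1 \<Longrightarrow> cmod ((deriv ^^ 2) F z) \<le> M"
    unfolding bounded_iff by blast
  have le: "zygmund_weight f z \<le> (1 - (cmod z)\<^sup>2) * M" if "z \<in> ball 0 1" for z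
    unfolding zygmund_weight_def deriv_eq[OF that]
    by (rule mult_left_mono) (use M that in \<open>auto simp: power_le_one\<close>)
  have "0 \<le> M"
    using M[of 0] norm_ge_zero[of "(deriv ^^ 2) F 0"] by (simp del: norm_ge_zero)
  have "bdd_above (zygmund_weight f ` ball 0 1)"
  proof (rule bdd_aboveI2)
    fix z :: complex assume "z \<in> ball 0 1"
    moreover have "(1 - (cmod z)\<^sup>2) * M \<le> 1 * M"
      using \<open>0 \<le> M\<close> by (intro mult_right_mono) auto
    ultimately show "zygmund_weight f z \<le> M"
      using le[of z] by simp
  qed
  moreover have "\<exists>h. continuous_on (cball 0 1) h \<and> (\<forall>z\<in>ball 0 1. h z = f z)"
    using hol sub by (intro exI[of _ F])
      (auto simp: f_def intro: holomorphic_on_imp_continuous_on holomorphic_on_subset)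
  moreover have "(zygmund_weight f \<longlongrightarrow> 0) (filtercomap cmod (at_left 1))"
  proof (rule Lim_null_comparison)
    show "\<forall>\<^sub>F z in filtercomap cmod (at_left 1). norm (zygmund_weight f z) \<le> (1 - (cmod z)\<^sup>2) * M"
      using eventually_in_disc
      by eventually_elim (use le zygmund_weight_nonneg[of _ f] in auto)
    have "((\<lambda>r. (1 - r\<^sup>2) * M) \<longlongrightarrow> (1 - 1\<^sup>2) * M) (at_left (1::real))"
      by (intro tendsto_intros)
    then show "((\<lambda>z. (1 - (cmod z)\<^sup>2) * M) \<longlongrightarrow> 0) (filtercomap cmod (at_left 1))"
      using filterlim_compose[OF _ filterlim_filtercomap, of "\<lambda>r. (1 - r\<^sup>2) * M" "nhds 0"] by simp
  qed
  moreover have "f 0 = 0" "deriv f 0 = 0"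
    using F deriv_eq[of 0 1] by (simp_all add: f_def)
  ultimately show "f \<in> little_zygmund00"
    using f1 by (simp add: little_zygmund00_def little_zygmund_def zygmund_def f_def)
qed

text \<open>Test functions can thus be prescribed through their second derivative. The primitives
  are taken on the larger ball and normalised to vanish at 0, which supplies both vanishing
  conditions.\<close>

lemma exists_second_primitive:
  fixes h :: "complex \<Rightarrow> complex"
  assumes "h holomorphic_on ball 0 R" "1 < R"
  obtains f where "f \<in> little_zygmund00" "\<And>z. z \<in> ball 0 1 \<Longrightarrow> (deriv ^^ 2) f z = h z"
proof -
  have prim: "\<exists>g. g 0 = 0 \<and> (\<forall>z\<in>ball 0 R. (g has_field_derivative u z) (at z))"
    if u: "u holomorphic_on ball 0 R" for u :: "complex \<Rightarrow> complex"
  proof -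
    obtain g where g: "\<And>z. z \<in> ball 0 R \<Longrightarrow> (g has_field_derivative u z) (at z within ball 0 R)"
      using holomorphic_convex_primitive'[OF convex_ball open_ball u] by blast
    have "((\<lambda>z. g z - g 0) has_field_derivative u z) (at z)" if "z \<in> ball 0 R" for z
      using g[OF that] that
      by (auto intro!: derivative_eq_intros simp: at_within_open[OF that open_ball])
    then show ?thesis
      by (intro exI[of _ "\<lambda>z. g z - g 0"]) auto
  qed
  obtain G where G: "G 0 = 0" "\<And>z. z \<in> ball 0 R \<Longrightarrow> (G has_field_derivative h z) (at z)"
    using prim[OF assms(1)] by blast
  have "G holomorphic_on ball 0 R"
    using G(2) by (meson holomorphic_on_open open_ball)
  then obtain F where F: "F 0 = 0" "\<And>z. z \<in> ball 0 R \<Longrightarrow> (F has_field_derivative G z) (at z)"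
    using prim by blast
  have dF: "deriv F z = G z" if "z \<in> ball 0 R" for z
    using F(2)[OF that] by (rule DERIV_imp_deriv)
  have "(deriv ^^ 2) F z = h z" if "z \<in> ball 0 R" for z
  proof -
    have "deriv (deriv F) z = h z"
      by (rule DERIV_imp_deriv, rule has_field_derivative_transform_within_open[OF G(2)[OF that] open_ball that])
         (simp add: dF)
    then show ?thesis
      by (simp add: numeral_2_eq_2)
  qed
  moreover have hol: "F holomorphic_on ball 0 R"
    using F(2) by (meson holomorphic_on_open open_ball)
  moreover have dF0: "deriv F 0 = 0"
    using dF[of 0] G(1) assms(2) by simp
  moreover note restriction_in_little_zygmund00[OF hol assms(2) F(1) dF0]
  ultimately show ?thesis
    using assms(2) by (intro that[of "\<lambda>z. if z \<in> ball 0 1 then F z else 0"]) auto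
qed

section \<open>Generators of isometry groups\<close>

lemma isometry_groupD:
  assumes "isometry_group T" "f \<in> little_zygmund00"
  shows isometry_group_in: "T t f \<in> little_zygmund00"
    and isometry_group_norm: "zygmund_norm (T t f) = zygmund_norm f"
  using assms unfolding isometry_group_def surj_lin_isometry_def by blast+

lemma isometry_group_lincomb:
  assumes "isometry_group T" "f \<in> little_zygmund00" "g \<in> little_zygmund00"
  shows "T t (\<lambda>z. a * f z + b * g z) = (\<lambda>z. a * T t f z + b * T t g z)"
  using assms unfolding isometry_group_def surj_lin_isometry_def by blast

lemma group_generator_in:
  assumes "(f, g) \<in> group_generator T"
  shows "f \<in> little_zygmund00" "g \<in> little_zygmund00"
  using assms by (auto simp: group_generator_def)

text \<open>The generator condition says that this function tends to 0 in norm. The name lets its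
  membership in the space be recorded for each \<open>t\<close>, as the comparison of weight and
  norm requires. At \<open>t = 0\<close> it is \<open>- g\<close>, which the limit ignores.\<close>

definition generator_defect ::
    "(real \<Rightarrow> (complex \<Rightarrow> complex) \<Rightarrow> (complex \<Rightarrow> complex)) \<Rightarrow> (complex \<Rightarrow> complex) \<Rightarrow>
     (complex \<Rightarrow> complex) \<Rightarrow> real \<Rightarrow> complex \<Rightarrow> complex" where
  "generator_defect T f g t = (\<lambda>z. - \<i> * ((T t f z - f z) / of_real t) - g z)"

text \<open>Nested combinations with explicit factors 1 and -1, so that the rules on linear
  combinations apply by matching.\<close>

lemma generator_defect_eq:
  "generator_defect T f g t = (\<lambda>z. 1 * (- \<i> / of_real t * T t f z + \<i> / of_real t * f z) + (- 1) * g z)"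
  by (rule ext, cases "t = 0") (simp_all add: generator_defect_def field_simps)

lemma generator_defect_in:
  assumes "isometry_group T" "f \<in> little_zygmund00" "g \<in> little_zygmund00"
  shows "generator_defect T f g t \<in> little_zygmund00"
proof -
  have "(\<lambda>z. - \<i> / of_real t * T t f z + \<i> / of_real t * f z) \<in> little_zygmund00"
    by (rule little_zygmund00_lincomb[OF isometry_group_in[OF assms(1,2)] assms(2)])
  from little_zygmund00_lincomb[OF this assms(3), of 1 "- 1"] show ?thesis
    unfolding generator_defect_eq .
qed

lemma generator_defect_tendsto:
  "(f, g) \<in> group_generator T \<Longrightarrow> ((\<lambda>t. zygmund_norm (generator_defect T f g t)) \<longlongrightarrow> 0) (at 0)"
  by (simp add: group_generator_def generator_defect_def)

text \<open>The defect of a combination is the same combination of the defects, so the triangle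
  inequality gives the limit.\<close>

lemma group_generator_lincomb:
  assumes T: "isometry_group T"
    and fg: "(f, g) \<in> group_generator T" "(f', g') \<in> group_generator T"
  shows "((\<lambda>z. a * f z + b * f' z), (\<lambda>z. a * g z + b * g' z)) \<in> group_generator T"
proof -
  let ?d = "generator_defect T f g" and ?d' = "generator_defect T f' g'"
  let ?f = "\<lambda>z. a * f z + b * f' z" and ?g = "\<lambda>z. a * g z + b * g' z"
  note in1 = group_generator_in[OF fg(1)] and in2 = group_generator_in[OF fg(2)]
  have eq: "generator_defect T ?f ?g t = (\<lambda>z. a * ?d t z + b * ?d' t z)" for t
    unfolding generator_defect_def isometry_group_lincomb[OF T in1(1) in2(1)]
    by (rule ext, cases "t = 0") (simp_all add: field_simps)
  have "((\<lambda>t. zygmund_norm (generator_defect T ?f ?g t)) \<longlongrightarrow> 0) (at 0)"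
  proof (rule Lim_null_comparison)
    show "\<forall>\<^sub>F t in at 0. norm (zygmund_norm (generator_defect T ?f ?g t))
        \<le> cmod a * zygmund_norm (?d t) + cmod b * zygmund_norm (?d' t)"
    proof (rule always_eventually, rule allI)
      fix t
      have "?d t \<in> little_zygmund00" "?d' t \<in> little_zygmund00"
        by (rule generator_defect_in[OF T in1] generator_defect_in[OF T in2])+
      then show "norm (zygmund_norm (generator_defect T ?f ?g t))
        \<le> cmod a * zygmund_norm (?d t) + cmod b * zygmund_norm (?d' t)"
        unfolding eq using zygmund_norm_lincomb_le[of "?d t" "?d' t" a b]
          zygmund_norm_nonneg[OF little_zygmund00_lincomb[of "?d t" "?d' t" a b]] by simp
    qed
    show "((\<lambda>t. cmod a * zygmund_norm (?d t) + cmod b * zygmund_norm (?d' t)) \<longlongrightarrow> 0) (at 0)"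
      using tendsto_add[OF tendsto_mult_left[OF generator_defect_tendsto[OF fg(1)], of "cmod a"]
          tendsto_mult_left[OF generator_defect_tendsto[OF fg(2)], of "cmod b"]] by simp
  qed
  moreover have "?f \<in> little_zygmund00" "?g \<in> little_zygmund00"
    by (rule little_zygmund00_lincomb[OF in1(1) in2(1)] little_zygmund00_lincomb[OF in1(2) in2(2)])+
  ultimately show ?thesis
    by (simp add: group_generator_def generator_defect_def)
qed

text \<open>The weight at the fixed point \<open>a\<close> is bounded by the norm and
  \<open>1 - |a|^2\<close> is positive, so norm convergence passes to second derivatives at
  \<open>a\<close>.\<close>

lemma group_generator_tendsto_deriv2:
  assumes T: "isometry_group T" and fg: "(f, g) \<in> group_generator T" and a: "a \<in> ball 0 1"
  shows "((\<lambda>t. - \<i> * (((deriv ^^ 2) (T t f) a - (deriv ^^ 2) f a) / of_real t))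
           \<longlongrightarrow> (deriv ^^ 2) g a) (at 0)"
    (is "(?q \<longlongrightarrow> _) _")
proof -
  note in1 = group_generator_in[OF fg]
  let ?d = "generator_defect T f g"
  define v where "v = 1 - (cmod a)\<^sup>2"
  have v: "0 < v"
    using a by (simp add: v_def abs_square_less_1)
  have d_eq: "(deriv ^^ 2) (?d t) a = ?q t - (deriv ^^ 2) g a" for t
  proof -
    let ?u = "\<lambda>z. - \<i> / of_real t * T t f z + \<i> / of_real t * f z"
    note Tf = isometry_group_in[OF T in1(1), of t]
    have u: "?u \<in> little_zygmund00"
      by (rule little_zygmund00_lincomb[OF Tf in1(1)])
    have "(deriv ^^ 2) (?d t) a = 1 * (deriv ^^ 2) ?u a + (- 1) * (deriv ^^ 2) g a"
      unfolding generator_defect_eq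
      by (rule higher_deriv_lincomb[OF little_zygmund00_holomorphic[OF u]
            little_zygmund00_holomorphic[OF in1(2)] open_ball a])
    also have "(deriv ^^ 2) ?u a
        = - \<i> / of_real t * (deriv ^^ 2) (T t f) a + \<i> / of_real t * (deriv ^^ 2) f a"
      by (rule higher_deriv_lincomb[OF little_zygmund00_holomorphic[OF Tf]
            little_zygmund00_holomorphic[OF in1(1)] open_ball a])
    finally show ?thesis
      by (cases "t = 0") (simp_all add: field_simps)
  qed
  have "((\<lambda>t. ?q t - (deriv ^^ 2) g a) \<longlongrightarrow> 0) (at 0)"
  proof (rule Lim_null_comparison)
    have "norm (?q t - (deriv ^^ 2) g a) \<le> zygmund_norm (?d t) / v" for t
      using zygmund_weight_le_norm[OF generator_defect_in[OF T in1] a, of t] v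
      by (simp add: zygmund_weight_def d_eq v_def[symmetric] pos_le_divide_eq mult.commute)
    then show "\<forall>\<^sub>F t in at 0. norm (?q t - (deriv ^^ 2) g a) \<le> zygmund_norm (?d t) / v"
      by simp
    show "((\<lambda>t. zygmund_norm (?d t) / v) \<longlongrightarrow> 0) (at 0)"
      using tendsto_divide_zero[OF generator_defect_tendsto[OF fg]] .
  qed
  then show ?thesis
    by (rule LIM_zero_cancel)
qed

text \<open>
  Evaluation of \<open>f''\<close> at a maximum point of the weight is, up to a scalar, a support functional
  of \<open>f\<close>, so the numerical range of the generator is real there.
\<close>

lemma group_generator_real_at_peak:
  assumes T: "isometry_group T" and fg: "(f, g) \<in> group_generator T" and a: "a \<in> ball 0 1"
    and peak: "\<And>z. z \<in> ball 0 1 \<Longrightarrow> zygmund_weight f z \<le> zygmund_weight f a"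
  shows "Im ((deriv ^^ 2) g a * cnj ((deriv ^^ 2) f a)) = 0"
proof -
  define c where "c = (deriv ^^ 2) f a"
  define u where "u t = (deriv ^^ 2) (T t f) a" for t
  define q where "q t = - \<i> * ((u t - c) / of_real t)" for t
  note in1 = group_generator_in[OF fg]
  \<comment> \<open>The peak condition bounds the norm of \<open>f\<close> by its weight at
    \<open>a\<close>; since \<open>T t\<close> preserves the norm, the orbit cannot exceed this
    value at \<open>a\<close>.\<close>
  have "zygmund_weight (T t f) a \<le> zygmund_weight f a" for t
    using zygmund_weight_le_norm[OF isometry_group_in[OF T in1(1)] a, of t]
      zygmund_norm_le[OF in1(1) peak] by (simp add: isometry_group_norm[OF T in1(1)])
  moreover have "0 < 1 - (cmod a)\<^sup>2"
    using a by (simp add: abs_square_less_1)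
  ultimately have ule: "cmod (u t) \<le> cmod c" for t
    by (simp add: zygmund_weight_def u_def c_def)
  \<comment> \<open>By \<open>ule\<close>, \<open>(u t - c) * cnj c\<close> has nonpositive real
    part, and \<open>u t - c = \<i> * t * q t\<close> turns this into a condition on an imaginary
    part. The factor \<open>t\<close> covers both signs: the limits from the right and from the left
    give opposite inequalities.\<close>
  have sgn: "0 \<le> t * Im (q t * cnj c)" for t
  proof (cases "t = 0")
    case False
    have "Re (u t * cnj c) \<le> cmod (u t) * cmod c"
      by (metis complex_Re_le_cmod complex_mod_cnj norm_mult)
    also have "\<dots> \<le> cmod c * cmod c"
      by (intro mult_right_mono ule norm_ge_zero)
    also have "\<dots> = Re (c * cnj c)"
      by (simp add: complex_norm_square[symmetric] power2_eq_square flip: of_real_mult)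
    finally have "Re ((u t - c) * cnj c) \<le> 0"
      by (simp add: algebra_simps)
    also have "u t - c = \<i> * of_real t * q t"
      using False by (simp add: q_def)
    finally show ?thesis
      by (simp add: algebra_simps)
  qed simp
  have lim: "((\<lambda>t. Im (q t * cnj c)) \<longlongrightarrow> Im ((deriv ^^ 2) g a * cnj c)) (at 0)"
    using group_generator_tendsto_deriv2[OF T fg a]
    unfolding q_def u_def c_def by (intro tendsto_intros)
  have "0 \<le> Im ((deriv ^^ 2) g a * cnj c)"
  proof (rule tendsto_lowerbound)
    show "((\<lambda>t. Im (q t * cnj c)) \<longlongrightarrow> Im ((deriv ^^ 2) g a * cnj c)) (at_right 0)"
      using lim by (rule filterlim_mono) (auto simp: at_le)
    show "\<forall>\<^sub>F t in at_right 0. 0 \<le> Im (q t * cnj c)"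
      using eventually_at_right_less[of 0]
      by eventually_elim (metis sgn zero_le_mult_iff not_less)
  qed simp
  moreover have "Im ((deriv ^^ 2) g a * cnj c) \<le> 0"
  proof (rule tendsto_upperbound)
    show "((\<lambda>t. Im (q t * cnj c)) \<longlongrightarrow> Im ((deriv ^^ 2) g a * cnj c)) (at_left 0)"
      using lim by (rule filterlim_mono) (auto simp: at_le)
    have "\<forall>\<^sub>F t in at_left (0::real). t < 0"
      by (simp add: eventually_at_filter)
    then show "\<forall>\<^sub>F t in at_left 0. Im (q t * cnj c) \<le> 0"
      by eventually_elim (metis sgn zero_le_mult_iff not_less)
  qed simp
  ultimately show ?thesis
    by (simp add: c_def)
qed

section \<open>Bounded generators\<close>

text \<open>Scaled so that the second derivative is \<open>z ^ n\<close>; the exponent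
  \<open>n + 2\<close> gives the double zero at 0 that the space demands.\<close>

definition disc_monomial :: "nat \<Rightarrow> complex \<Rightarrow> complex" where
  "disc_monomial n z = (if z \<in> ball 0 1 then z ^ (n + 2) / (of_nat (n + 1) * of_nat (n + 2)) else 0)"

lemma disc_monomial_in: "disc_monomial n \<in> little_zygmund00"
  and deriv_disc_monomial: "z \<in> ball 0 1 \<Longrightarrow> deriv (disc_monomial n) z = z ^ (n + 1) / of_nat (n + 1)"
  and deriv2_disc_monomial: "z \<in> ball 0 1 \<Longrightarrow> (deriv ^^ 2) (disc_monomial n) z = z ^ n"
proof -
  define F :: "complex \<Rightarrow> complex" where "F = (\<lambda>z. z ^ (n + 2) / (of_nat (n + 1) * of_nat (n + 2)))"
  have nz: "of_nat (n + 1) \<noteq> (0::complex)" "of_nat (n + 2) \<noteq> (0::complex)"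
    by (simp_all only: of_nat_eq_0_iff)
  have dF: "deriv F = (\<lambda>z. z ^ (n + 1) / of_nat (n + 1))"
  proof (rule ext, rule DERIV_imp_deriv)
    fix z
    show "(F has_field_derivative z ^ (n + 1) / of_nat (n + 1)) (at z)"
      unfolding F_def
      by (rule DERIV_cong[OF DERIV_cdivide[OF DERIV_power[OF DERIV_ident]]])
         (use nz in \<open>simp del: of_nat_add of_nat_Suc\<close>)
  qed
  have ddF: "(deriv ^^ 2) F = (\<lambda>z. z ^ n)"
  proof -
    have "deriv (deriv F) = (\<lambda>z. z ^ n)"
      unfolding dF
    proof (rule ext, rule DERIV_imp_deriv)
      fix z :: complex
      show "((\<lambda>z. z ^ (n + 1) / of_nat (n + 1)) has_field_derivative z ^ n) (at z)"
        by (rule DERIV_cong[OF DERIV_cdivide[OF DERIV_power[OF DERIV_ident]]])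
           (use nz in \<open>simp del: of_nat_add of_nat_Suc\<close>)
    qed
    then show ?thesis
      by (simp add: numeral_2_eq_2)
  qed
  have hol: "F holomorphic_on ball 0 2"
    unfolding F_def using nz by (intro holomorphic_intros) auto
  have F0: "F 0 = 0" "deriv F 0 = 0"
    unfolding dF by (simp_all add: F_def)
  have eq: "disc_monomial n = (\<lambda>z. if z \<in> ball 0 1 then F z else 0)"
    by (simp add: fun_eq_iff disc_monomial_def F_def)
  note restr = restriction_in_little_zygmund00[OF hol _ F0, folded eq]
  show "disc_monomial n \<in> little_zygmund00"
    using restr(1) by simp
  show "deriv (disc_monomial n) z = z ^ (n + 1) / of_nat (n + 1)" if "z \<in> ball 0 1"
    using restr(2)[of z 1] that by (simp add: dF)
  show "(deriv ^^ 2) (disc_monomial n) z = z ^ n" if "z \<in> ball 0 1"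
    using restr(2)[of z 2] that by (simp add: ddF)
qed

lemma deriv3_disc_monomial:
  assumes "z \<in> ball 0 1"
  shows "(deriv ^^ 3) (disc_monomial n) z = of_nat n * z ^ (n - 1)"
proof -
  have "deriv ((deriv ^^ 2) (disc_monomial n)) z = deriv (\<lambda>z. z ^ n) z"
  proof (rule complex_derivative_transform_within_open[OF _ _ open_ball assms])
    show "(deriv ^^ 2) (disc_monomial n) holomorphic_on ball 0 1"
      by (intro holomorphic_higher_deriv little_zygmund00_holomorphic disc_monomial_in open_ball)
  qed (auto intro!: holomorphic_intros simp: deriv2_disc_monomial)
  also have "\<dots> = of_nat n * z ^ (n - 1)"
    by (rule DERIV_imp_deriv, rule DERIV_cong[OF DERIV_power[OF DERIV_ident]]) simp
  finally show ?thesis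
    by (simp add: numeral_eq_Suc)
qed

text \<open>\<open>r ^ n\<close> is the least of the powers up to \<open>n\<close>, so
  \<open>(n + 1) * r ^ n\<close> is below the geometric sum, which telescopes against
  \<open>1 - r\<close>.\<close>

lemma one_minus_mult_power_le:
  fixes r :: real
  assumes "0 \<le> r" "r \<le> 1"
  shows "(1 - r) * r ^ n \<le> 1 / (real n + 1)"
proof -
  have "(real n + 1) * r ^ n \<le> (\<Sum>k<n + 1. r ^ k)"
  proof -
    have "(\<Sum>k<n + 1. r ^ n) \<le> (\<Sum>k<n + 1. r ^ k)"
      by (intro sum_mono power_decreasing) (use assms in auto)
    then show ?thesis by (simp add: add.commute)
  qed
  then have "(1 - r) * ((real n + 1) * r ^ n) \<le> (1 - r) * (\<Sum>k<n + 1. r ^ k)"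
    using assms by (intro mult_left_mono) auto
  also have "\<dots> = 1 - r ^ (n + 1)"
    by (simp only: one_diff_power_eq)
  also have "\<dots> \<le> 1"
    using assms by simp
  finally show ?thesis
    by (simp add: field_simps)
qed

text \<open>A bounded generator must preserve this decay of order \<open>1 / n\<close>, whereas
  differentiating \<open>z ^ n\<close> costs a factor \<open>n\<close>; this conflict later removes
  the first-order coefficient.\<close>

lemma zygmund_norm_disc_monomial_le: "zygmund_norm (disc_monomial n) \<le> 2 / (real n + 1)"
proof (rule zygmund_norm_le[OF disc_monomial_in])
  fix z :: complex assume z: "z \<in> ball 0 1"
  let ?r = "cmod z"
  have "zygmund_weight (disc_monomial n) z = (1 + ?r) * ((1 - ?r) * ?r ^ n)"
    using z by (simp add: zygmund_weight_def deriv2_disc_monomial norm_power power2_eq_square algebra_simps)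
  also have "\<dots> \<le> 2 * (1 / (real n + 1))"
    using z one_minus_mult_power_le[of ?r n] by (intro mult_mono) auto
  finally show "zygmund_weight (disc_monomial n) z \<le> 2 / (real n + 1)"
    by simp
qed

section \<open>Peak functions\<close>

text \<open>Divided by \<open>|1 - cnj a * z|^2\<close>, the right side becomes one minus the
  squared pseudohyperbolic distance. The proof expands \<open>|w|^2 = w * cnj w\<close> in the
  complex numbers.\<close>

lemma disc_weight_identity:
  "(1 - (cmod z)\<^sup>2) * (1 - (cmod a)\<^sup>2) = (cmod (1 - cnj a * z))\<^sup>2 - (cmod (z - a))\<^sup>2"
proof -
  have "of_real ((1 - (cmod z)\<^sup>2) * (1 - (cmod a)\<^sup>2))
      = (of_real ((cmod (1 - cnj a * z))\<^sup>2 - (cmod (z - a))\<^sup>2) :: complex)"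
    by (simp only: of_real_mult of_real_diff of_real_1 complex_norm_square complex_cnj_diff
        complex_cnj_mult complex_cnj_one complex_cnj_cnj) (simp add: algebra_simps)
  then show ?thesis
    by (simp only: of_real_eq_iff)
qed

text \<open>For the second derivative \<open>1 / (1 - cnj a * z)^2\<close> the preceding identity
  turns the scaled weight into \<open>1 - |z - a|^2 / |1 - cnj a * z|^2\<close>, and the denominator
  is at most 4. The quadratic gap around \<open>a\<close> is the room for perturbations.\<close>

lemma exists_peak_function:
  assumes a: "a \<in> ball 0 1"
  obtains p where "p \<in> little_zygmund00"
    and "(deriv ^^ 2) p a = of_real (1 / (1 - (cmod a)\<^sup>2)\<^sup>2)"
    and "\<And>z. z \<in> ball 0 1 \<Longrightarrow> (1 - (cmod a)\<^sup>2) * zygmund_weight p z \<le> 1 - (cmod (z - a))\<^sup>2 / 4"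
proof -
  \<comment> \<open>This radius lies strictly between 1 and \<open>1 / |a|\<close>, and it makes
    sense for \<open>a = 0\<close> as well.\<close>
  define R where "R = 2 / (1 + cmod a)"
  have a1: "cmod a < 1"
    using a by simp
  then have "1 < R"
    by (simp add: R_def field_simps add_pos_nonneg)
  have nz: "1 - cnj a * z \<noteq> 0" if "z \<in> ball 0 R" for z
  proof
    assume "1 - cnj a * z = 0"
    then have "1 = cmod (cnj a * z)"
      by simp
    also have "\<dots> \<le> cmod a * R"
      using that by (auto simp: norm_mult intro: mult_left_mono)
    also have "\<dots> < 1"
      using a1 by (simp add: R_def field_simps add_pos_nonneg)
    finally show False by simp
  qed
  have "(\<lambda>z. 1 / (1 - cnj a * z)\<^sup>2) holomorphic_on ball 0 R"
    by (intro holomorphic_intros) (use nz in auto)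
  then obtain p where p: "p \<in> little_zygmund00"
    "\<And>z. z \<in> ball 0 1 \<Longrightarrow> (deriv ^^ 2) p z = 1 / (1 - cnj a * z)\<^sup>2"
    using exists_second_primitive[OF _ \<open>1 < R\<close>] by blast
  have "(deriv ^^ 2) p a = of_real (1 / (1 - (cmod a)\<^sup>2)\<^sup>2)"
  proof -
    have "cnj a * a = of_real ((cmod a)\<^sup>2)"
      by (simp only: complex_norm_square mult.commute)
    then show ?thesis
      unfolding p(2)[OF a] by (simp only: of_real_divide of_real_power of_real_diff of_real_1)
  qed
  moreover have "(1 - (cmod a)\<^sup>2) * zygmund_weight p z \<le> 1 - (cmod (z - a))\<^sup>2 / 4"
    if z: "z \<in> ball 0 1" for z
  proof -
    let ?m = "(cmod (1 - cnj a * z))\<^sup>2"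
    have m0: "0 < ?m"
      using nz[of z] z \<open>1 < R\<close> by auto
    have "cmod (1 - cnj a * z) \<le> cmod 1 + cmod (cnj a * z)"
      by (rule norm_triangle_ineq4)
    also have "\<dots> \<le> 1 + 1 * 1"
      unfolding norm_mult using z a1 by (intro add_mono mult_mono) auto
    finally have m4: "?m \<le> 4"
      using power_mono[of "cmod (1 - cnj a * z)" 2 2] by simp
    have "(1 - (cmod a)\<^sup>2) * zygmund_weight p z = ((1 - (cmod z)\<^sup>2) * (1 - (cmod a)\<^sup>2)) / ?m"
      by (simp add: zygmund_weight_def p(2)[OF z] norm_divide norm_power)
    also have "\<dots> = 1 - (cmod (z - a))\<^sup>2 / ?m"
      unfolding disc_weight_identity using m0 by (simp add: diff_divide_distrib)
    also have "\<dots> \<le> 1 - (cmod (z - a))\<^sup>2 / 4"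
      using m0 by (intro diff_left_mono divide_left_mono m4) auto
    finally show ?thesis .
  qed
  ultimately show ?thesis
    using p(1) that by blast
qed

section \<open>Perturbation of peaks\<close>

text \<open>Near \<open>a\<close> only the quadratic remainder of the Taylor formula is left; away
  from \<open>a\<close> the weight is at most the norm while \<open>|z - a|\<close> is bounded
  below.\<close>

lemma zygmund_weight_double_zero:
  assumes k: "k \<in> little_zygmund00" and a: "a \<in> ball 0 1"
    and zero: "(deriv ^^ 2) k a = 0" "(deriv ^^ 3) k a = 0"
  obtains C where "0 < C" "\<And>z. z \<in> ball 0 1 \<Longrightarrow> zygmund_weight k z \<le> C * (cmod (z - a))\<^sup>2"
proof -
  note hol = little_zygmund00_holomorphic[OF k]
  obtain \<rho> where \<rho>: "0 < \<rho>" "cball a \<rho> \<subseteq> ball 0 1"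
    using open_contains_cball[of "ball 0 (1::real) :: complex set"] a by (meson open_ball)
  have "continuous_on (cball a \<rho>) ((deriv ^^ 4) k)"
    by (rule holomorphic_on_imp_continuous_on, rule holomorphic_on_subset[OF _ \<rho>(2)])
       (intro holomorphic_higher_deriv hol open_ball)
  then have "bounded ((deriv ^^ 4) k ` cball a \<rho>)"
    by (intro compact_imp_bounded compact_continuous_image compact_cball)
  then obtain B where B: "\<And>z. z \<in> cball a \<rho> \<Longrightarrow> cmod ((deriv ^^ 4) k z) \<le> B"
    unfolding bounded_iff by blast
  have B0: "0 \<le> B"
    using B[of a] \<rho>(1) norm_ge_zero[of "(deriv ^^ 4) k a"] by (simp del: norm_ge_zero)
  let ?M = "zygmund_norm k"
  have M0: "0 \<le> ?M"
    by (rule zygmund_norm_nonneg[OF k])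
  \<comment> \<open>The Taylor formula is applied to the second derivative, so its two leading
    coefficients are those in \<open>zero\<close> and the remainder involves the fourth
    derivative.\<close>
  have taylor: "cmod ((deriv ^^ 2) k z) \<le> B * (cmod (z - a))\<^sup>2" if z: "z \<in> cball a \<rho>" for z
  proof -
    have "cmod ((deriv ^^ (0 + 2)) k z - (\<Sum>i\<le>1. (deriv ^^ (i + 2)) k a * (z - a) ^ i / fact i))
        \<le> B * cmod (z - a) ^ Suc 1 / fact 1"
    proof (rule complex_Taylor[where S = "cball a \<rho>" and f = "\<lambda>i. (deriv ^^ (i + 2)) k"])
      show "((deriv ^^ (i + 2)) k has_field_derivative (deriv ^^ (Suc i + 2)) k x) (at x within cball a \<rho>)"
        if "x \<in> cball a \<rho>" for i x
      proof -
        have "x \<in> ball 0 1"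
          using that \<rho>(2) by blast
        from has_field_derivative_higher_deriv[OF hol open_ball this, of "i + 2"]
        show ?thesis
          by (simp only: add_Suc has_field_derivative_at_within)
      qed
      show "cmod ((deriv ^^ (Suc 1 + 2)) k x) \<le> B" if "x \<in> cball a \<rho>" for x
        using B[OF that] by (simp add: numeral_eq_Suc)
    qed (use z \<rho> in auto)
    then show ?thesis
      using zero by (simp add: numeral_eq_Suc)
  qed
  show ?thesis
  \<comment> \<open>\<open>B\<close> serves the small disc and \<open>?M / \<rho>\<^sup>2\<close>
    its complement; the summand 1 makes the constant positive.\<close>
  proof (rule that[of "B + ?M / \<rho>\<^sup>2 + 1"])
    show "0 < B + ?M / \<rho>\<^sup>2 + 1"
      using B0 M0 by (simp add: add_nonneg_pos)
    fix z :: complex assume z: "z \<in> ball 0 1"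
    show "zygmund_weight k z \<le> (B + ?M / \<rho>\<^sup>2 + 1) * (cmod (z - a))\<^sup>2"
    proof (cases "z \<in> cball a \<rho>")
      case True
      have "zygmund_weight k z \<le> 1 * cmod ((deriv ^^ 2) k z)"
        unfolding zygmund_weight_def by (intro mult_right_mono) auto
      also have "\<dots> \<le> B * (cmod (z - a))\<^sup>2"
        using taylor[OF True] by simp
      also have "\<dots> \<le> (B + ?M / \<rho>\<^sup>2 + 1) * (cmod (z - a))\<^sup>2"
        using M0 by (intro mult_right_mono) auto
      finally show ?thesis .
    next
      case False
      then have "\<rho>\<^sup>2 \<le> (cmod (z - a))\<^sup>2"
        using \<rho>(1) by (intro power_mono) (auto simp: dist_norm norm_minus_commute)
      then have "?M \<le> ?M / \<rho>\<^sup>2 * (cmod (z - a))\<^sup>2"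
        using M0 \<rho>(1) by (simp add: field_simps mult_left_mono)
      also have "\<dots> \<le> (B + ?M / \<rho>\<^sup>2 + 1) * (cmod (z - a))\<^sup>2"
        using B0 by (intro mult_right_mono) auto
      finally show ?thesis
        using zygmund_weight_le_norm[OF k z] by linarith
    qed
  qed
qed

text \<open>
  A small multiple of \<open>k\<close> can be added to the peak function at \<open>a\<close> without moving the peak,
  because \<open>k''\<close> vanishes there to second order.
\<close>

lemma group_generator_deriv2_eq_zero:
  assumes T: "isometry_group T" and a: "a \<in> ball 0 1"
    and p: "(p, q) \<in> group_generator T" "(deriv ^^ 2) p a = of_real (1 / (1 - (cmod a)\<^sup>2)\<^sup>2)"
    and peak: "\<And>z. z \<in> ball 0 1 \<Longrightarrow> (1 - (cmod a)\<^sup>2) * zygmund_weight p z \<le> 1 - (cmod (z - a))\<^sup>2 / 4"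
    and k: "(k, l) \<in> group_generator T" "(deriv ^^ 2) k a = 0" "(deriv ^^ 3) k a = 0"
  shows "(deriv ^^ 2) l a = 0"
proof -
  define v where "v = 1 - (cmod a)\<^sup>2"
  have v: "0 < v" "v \<le> 1"
    using a by (simp_all add: v_def abs_square_less_1)
  note p_in = group_generator_in[OF p(1)] and k_in = group_generator_in[OF k(1)]
  obtain C where C: "0 < C" "\<And>z. z \<in> ball 0 1 \<Longrightarrow> zygmund_weight k z \<le> C * (cmod (z - a))\<^sup>2"
    using zygmund_weight_double_zero[OF k_in(1) a k(2,3)] by blast
  \<comment> \<open>The perturbation then adds at most \<open>|z - a|^2 / 4\<close>, exactly the gap
    left by the peak.\<close>
  define \<delta> where "\<delta> = 1 / (4 * C)"
  have \<delta>: "0 < \<delta>"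
    using C(1) by (simp add: \<delta>_def)
  \<comment> \<open>The perturbed function still peaks at \<open>a\<close>, with the same real
    second derivative there, so reality holds for a whole disc of parameters.\<close>
  have real: "Im ((deriv ^^ 2) q a + \<epsilon> * (deriv ^^ 2) l a) = 0" if \<epsilon>: "cmod \<epsilon> \<le> \<delta>" for \<epsilon>
  proof -
    let ?f = "\<lambda>z. 1 * p z + \<epsilon> * k z" and ?g = "\<lambda>z. 1 * q z + \<epsilon> * l z"
    have d2f: "(deriv ^^ 2) ?f a = of_real (1 / v\<^sup>2)"
      using higher_deriv_lincomb[OF little_zygmund00_holomorphic[OF p_in(1)]
          little_zygmund00_holomorphic[OF k_in(1)] open_ball a, of 2 1 \<epsilon>] p(2) k(2)
      by (simp add: v_def)
    have d2g: "(deriv ^^ 2) ?g a = (deriv ^^ 2) q a + \<epsilon> * (deriv ^^ 2) l a"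
      using higher_deriv_lincomb[OF little_zygmund00_holomorphic[OF p_in(2)]
          little_zygmund00_holomorphic[OF k_in(2)] open_ball a, of 2 1 \<epsilon>] by simp
    have "zygmund_weight ?f a = 1 / v"
      unfolding zygmund_weight_def d2f v_def[symmetric] using v
      by (simp add: norm_divide norm_mult power2_eq_square)
    moreover have "zygmund_weight ?f z \<le> 1 / v" if z: "z \<in> ball 0 1" for z
    proof -
      have "v * zygmund_weight ?f z \<le> v * (1 * zygmund_weight p z + cmod \<epsilon> * zygmund_weight k z)"
        using zygmund_weight_lincomb_le[OF little_zygmund00_holomorphic[OF p_in(1)]
          little_zygmund00_holomorphic[OF k_in(1)] z, of 1 \<epsilon>] v by (intro mult_left_mono) auto
      also have "\<dots> \<le> v * zygmund_weight p z + cmod \<epsilon> * zygmund_weight k z"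
        using v zygmund_weight_nonneg[OF z, of k] by (simp add: distrib_left mult_left_le_one_le)
      also have "\<dots> \<le> (1 - (cmod (z - a))\<^sup>2 / 4) + \<delta> * (C * (cmod (z - a))\<^sup>2)"
        using peak[OF z] C(2)[OF z] \<epsilon> \<delta> zygmund_weight_nonneg[OF z, of k]
        unfolding v_def by (intro add_mono mult_left_mono mult_mono) auto
      also have "\<dots> = 1"
        using C(1) by (simp add: \<delta>_def)
      finally show ?thesis
        using v by (simp add: field_simps)
    qed
    ultimately have "zygmund_weight ?f z \<le> zygmund_weight ?f a" if "z \<in> ball 0 1" for z
      using that by presburger
    then have "Im ((deriv ^^ 2) ?g a * cnj ((deriv ^^ 2) ?f a)) = 0"
      by (rule group_generator_real_at_peak[OF T group_generator_lincomb[OF T p(1) k(1)] a])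
    then show ?thesis
      unfolding d2f d2g using v by (simp add: complex_eq_iff)
  qed
  \<comment> \<open>The parameter 0 disposes of the \<open>q\<close> term; \<open>\<delta>\<close>
    and \<open>\<i> * \<delta>\<close> then kill the imaginary and the real part of the remaining
    value.\<close>
  have "Im ((deriv ^^ 2) q a) = 0"
    using real[of 0] \<delta> by simp
  then show ?thesis
    using real[of "of_real \<delta>"] real[of "\<i> * of_real \<delta>"] \<delta> by (simp add: norm_mult complex_eq_iff)
qed

section \<open>First-order form of an everywhere defined generator\<close>

text \<open>Subtracting from \<open>f\<close> a combination of the two monomials leaves a function
  whose second derivative has a double zero at \<open>a\<close>, so its image contributes nothing
  there. The images \<open>A\<close> and \<open>E\<close> therefore determine that of
  \<open>f\<close>.\<close>

lemma group_generator_first_order: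
  assumes T: "isometry_group T" and dom: "Domain (group_generator T) = little_zygmund00"
    and e0: "(disc_monomial 0, A) \<in> group_generator T"
    and e1: "(disc_monomial 1, E) \<in> group_generator T"
    and fg: "(f, g) \<in> group_generator T" and a: "a \<in> ball 0 1"
  shows "(deriv ^^ 2) g a = (deriv ^^ 2) f a * (deriv ^^ 2) A a
           + (deriv ^^ 3) f a * ((deriv ^^ 2) E a - a * (deriv ^^ 2) A a)"
proof -
  obtain p where p: "p \<in> little_zygmund00" "(deriv ^^ 2) p a = of_real (1 / (1 - (cmod a)\<^sup>2)\<^sup>2)"
    "\<And>z. z \<in> ball 0 1 \<Longrightarrow> (1 - (cmod a)\<^sup>2) * zygmund_weight p z \<le> 1 - (cmod (z - a))\<^sup>2 / 4"
    using exists_peak_function[OF a] by blast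
  obtain q where q: "(p, q) \<in> group_generator T"
    using p(1) dom by blast
  \<comment> \<open>\<open>c + d * z\<close> is the tangent line at \<open>a\<close> of the second
    derivative of \<open>f\<close>.\<close>
  define c where "c = (deriv ^^ 2) f a - a * (deriv ^^ 3) f a"
  define d where "d = (deriv ^^ 3) f a"
  let ?u = "\<lambda>z. c * disc_monomial 0 z + d * disc_monomial 1 z"
  let ?k = "\<lambda>z. 1 * f z + (- 1) * ?u z"
  let ?w = "\<lambda>z. c * A z + d * E z"
  let ?l = "\<lambda>z. 1 * g z + (- 1) * ?w z"
  have u: "(?u, ?w) \<in> group_generator T"
    by (rule group_generator_lincomb[OF T e0 e1])
  have k: "(?k, ?l) \<in> group_generator T"
    by (rule group_generator_lincomb[OF T fg u])
  note hol = little_zygmund00_holomorphic[OF group_generator_in(1)]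
    little_zygmund00_holomorphic[OF group_generator_in(2)]
  have D: "(deriv ^^ n) ?k a = (deriv ^^ n) f a
      - (c * (deriv ^^ n) (disc_monomial 0) a + d * (deriv ^^ n) (disc_monomial 1) a)"
    "(deriv ^^ n) ?l a = (deriv ^^ n) g a - (c * (deriv ^^ n) A a + d * (deriv ^^ n) E a)" for n
    by (simp_all only: higher_deriv_lincomb[OF hol(1)[OF fg] hol(1)[OF u] open_ball a]
        higher_deriv_lincomb[OF hol(1)[OF e0] hol(1)[OF e1] open_ball a]
        higher_deriv_lincomb[OF hol(2)[OF fg] hol(2)[OF u] open_ball a]
        higher_deriv_lincomb[OF hol(2)[OF e0] hol(2)[OF e1] open_ball a]) simp_all
  have k0: "(deriv ^^ 2) ?k a = 0" "(deriv ^^ 3) ?k a = 0"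
    unfolding D using a by (simp_all add: deriv2_disc_monomial deriv3_disc_monomial c_def d_def)
  have "(deriv ^^ 2) ?l a = 0"
    by (rule group_generator_deriv2_eq_zero[OF T a q p(2,3) k k0])
  then show ?thesis
    unfolding D by (simp add: c_def d_def algebra_simps)
qed

section \<open>Reduction to a real scalar\<close>

text \<open>Otherwise the open mapping theorem would make the image open, but it lies in the real
  line.\<close>

lemma holomorphic_real_valued_imp_constant:
  assumes "f holomorphic_on S" "open S" "connected S" "\<And>z. z \<in> S \<Longrightarrow> Im (f z) = 0"
  shows "f constant_on S"
proof (rule ccontr)
  assume nc: "\<not> f constant_on S"
  then obtain z where z: "z \<in> S"
    by (auto simp: constant_on_def)
  have "open (f ` S)"
    by (rule open_mapping_thm[OF assms(1-3) assms(2) subset_refl nc])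
  then obtain e where e: "0 < e" "ball (f z) e \<subseteq> f ` S"
    using z by (meson imageI open_contains_ball)
  then have "f z + \<i> * of_real (e / 2) \<in> f ` S"
    by (intro subsetD[OF e(2)]) (simp add: dist_norm norm_mult)
  then obtain w where "w \<in> S" "f w = f z + \<i> * of_real (e / 2)"
    by auto
  then show False
    using assms(4)[of w] assms(4)[OF z] e(1) by simp
qed

text \<open>
  On \<open>|z| = m / (m + 1)\<close> the images of the monomials of norm \<open>O(1 / m)\<close> force the coefficient \<open>B\<close>
  of the first-order part to be \<open>o(1)\<close>.
\<close>

lemma first_order_coefficient_eq_zero:
  assumes A: "A \<in> little_zygmund00" and B: "B holomorphic_on ball 0 1"
    and bound: "\<And>n z. z \<in> ball 0 1 \<Longrightarrow>
      (1 - (cmod z)\<^sup>2) * cmod (z ^ Suc n * (deriv ^^ 2) A z + of_nat (Suc n) * z ^ n * B z) \<le> K / real (Suc n)"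
    and w: "w \<in> ball 0 1"
  shows "B w = 0"
proof (rule ccontr)
  assume "B w \<noteq> 0"
  \<comment> \<open>The estimate on the circle will be \<open>6 * \<epsilon>\<close>, which the
    denominator 8 keeps below \<open>|B w|\<close>.\<close>
  define \<epsilon> where "\<epsilon> = cmod (B w) / 8"
  have \<epsilon>: "0 < \<epsilon>"
    using \<open>B w \<noteq> 0\<close> by (simp add: \<epsilon>_def)
  \<comment> \<open>Here \<open>1 - r m = 1 / (m + 1)\<close> cancels the factor from
    differentiation, while \<open>r m ^ m\<close> stays away from 0.\<close>
  define r where "r m = real m / (real m + 1)" for m
  have r: "0 \<le> r m" "r m < 1" for m
    by (auto simp: r_def)
  obtain P where P: "eventually P (at_left 1)" "\<And>z. P (cmod z) \<Longrightarrow> zygmund_weight A z < \<epsilon>"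
    using order_tendstoD(2)[OF little_zygmund00_tendsto[OF A] \<epsilon>]
    by (auto simp: eventually_filtercomap)
  have r1: "r \<longlonglongrightarrow> 1"
    unfolding r_def by real_asymp
  then have "filterlim r (at_left 1) sequentially"
    unfolding filterlim_at using r by (auto intro!: always_eventually simp: less_imp_neq)
  then have "\<forall>\<^sub>F m in sequentially. P (r m)"
    using P(1) by (rule eventually_compose_filterlim[rotated])
  moreover have "\<forall>\<^sub>F m in sequentially. cmod w < r m"
    using order_tendstoD(1)[OF r1, of "cmod w"] w by simp
  moreover have "(\<lambda>m. K / real (Suc m)) \<longlonglongrightarrow> 0"
    by real_asymp
  then have "\<forall>\<^sub>F m in sequentially. K / real (Suc m) < \<epsilon>"
    using \<epsilon> by (rule order_tendstoD(2))
  ultimately have "\<forall>\<^sub>F m in sequentially. P (r m) \<and> cmod w < r m \<and> K / real (Suc m) < \<epsilon>"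
    by eventually_elim simp
  then obtain m where m: "P (r m)" "cmod w < r m" "K / real (Suc m) < \<epsilon>"
    using eventually_happens by fastforce
  define s where "s = real m"
  \<comment> \<open>For positive \<open>m\<close> this power is the reciprocal of
    \<open>(1 + 1 / m) ^ m\<close>, which is at most \<open>exp 1 \<le> 3\<close>; for
    \<open>m = 0\<close> both powers are 1.\<close>
  have rm: "1 / 3 \<le> r m ^ m"
  proof -
    have "(1 + 1 / s) ^ m \<le> exp (1 / s) ^ m"
      unfolding s_def by (intro power_mono) auto
    also have "\<dots> = exp (s * (1 / s))"
      by (simp only: s_def exp_of_nat_mult)
    also have "\<dots> \<le> 3"
      using exp_le by (cases "s = 0") auto
    finally have "(1 + 1 / s) ^ m \<le> 3" .
    moreover have "1 \<le> r m ^ m * (1 + 1 / s) ^ m"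
    proof (cases "m = 0")
      case False
      then have "1 + 1 / s = (real m + 1) / real m"
        by (simp add: s_def field_simps)
      moreover have "real m + 1 \<noteq> 0"
        by linarith
      ultimately have "r m * (1 + 1 / s) = 1"
        using False by (simp add: r_def)
      then show ?thesis
        by (simp flip: power_mult_distrib)
    qed simp
    ultimately show ?thesis
      using r(1)[of m] mult_left_mono[of "(1 + 1 / s) ^ m" 3 "r m ^ m"] by auto
  qed
  have frontier: "cmod (B z) \<le> 6 * \<epsilon>" if "z \<in> frontier (cball 0 (r m))" for z
  proof -
    have z: "cmod z = r m" "z \<in> ball 0 1"
      using that r[of m] by auto
    let ?v = "1 - (cmod z)\<^sup>2"
    let ?x = "z ^ Suc m * (deriv ^^ 2) A z" and ?y = "of_nat (Suc m) * z ^ m * B z"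
    have v: "0 \<le> ?v"
      using z(2) by (simp add: power_le_one)
    have "?v * cmod ?y \<le> ?v * (cmod (?x + ?y) + cmod ?x)"
      using v norm_triangle_ineq4[of "?x + ?y" ?x] by (intro mult_left_mono) simp_all
    also have "\<dots> = ?v * cmod (?x + ?y) + cmod z ^ Suc m * zygmund_weight A z"
      by (simp add: zygmund_weight_def norm_mult norm_power algebra_simps)
    \<comment> \<open>The first \<open>\<epsilon>\<close> is the assumed bound; the second is the
      decay of the weight of \<open>A\<close> at the circle, where membership in the little space
      enters.\<close>
    also have "\<dots> \<le> \<epsilon> + 1 * \<epsilon>"
    proof (intro add_mono mult_mono)
      show "?v * cmod (?x + ?y) \<le> \<epsilon>"
        using bound[OF z(2), of m] m(3) by linarith
      show "cmod z ^ Suc m \<le> 1"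
        using r[of m] z(1) by (intro power_le_one) auto
      show "zygmund_weight A z \<le> \<epsilon>"
        using P(2)[of z] m(1) z(1) by simp
      show "0 \<le> zygmund_weight A z"
        using z(2) by (rule zygmund_weight_nonneg)
    qed auto
    finally have up: "?v * cmod ?y \<le> 2 * \<epsilon>"
      by simp
    have "1 / (real m + 1) \<le> ?v"
    proof -
      have "1 - r m * 1 \<le> 1 - r m * r m"
        using r[of m] by (intro diff_left_mono mult_left_mono) auto
      moreover have "1 - r m = 1 / (real m + 1)"
        by (simp add: r_def field_simps)
      ultimately show ?thesis
        by (simp add: z(1) power2_eq_square)
    qed
    then have "1 / (real m + 1) * (real (Suc m) * (1 / 3 * cmod (B z))) \<le> ?v * (real (Suc m) * (r m ^ m * cmod (B z)))"
      using rm v by (intro mult_mono) auto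
    also have "\<dots> = ?v * cmod ?y"
      by (simp add: norm_mult norm_power z(1) mult.assoc del: of_nat_Suc)
    also have "\<dots> \<le> 2 * \<epsilon>"
      by (rule up)
    also have "1 / (real m + 1) * (real (Suc m) * (1 / 3 * cmod (B z))) = 1 / 3 * cmod (B z)"
      by (simp add: add.commute)
    finally show ?thesis
      by simp
  qed
  have "cmod (B w) \<le> 6 * \<epsilon>"
  proof (rule maximum_modulus_frontier[of B "cball 0 (r m)"])
    have sub: "cball 0 (r m) \<subseteq> ball (0::complex) 1"
      using r[of m] by auto
    then show "B holomorphic_on interior (cball 0 (r m))"
      using interior_subset by (blast intro: holomorphic_on_subset[OF B])
    show "continuous_on (closure (cball 0 (r m))) B"
      using sub by (simp add: holomorphic_on_imp_continuous_on holomorphic_on_subset[OF B])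
  qed (use frontier m(2) in auto)
  then show False
    using \<epsilon> by (simp add: \<epsilon>_def)
qed

lemma bounded_opE:
  assumes "bounded_op G"
  obtains C where "\<And>f g. (f, g) \<in> G \<Longrightarrow> zygmund_norm g \<le> C * zygmund_norm f"
  using assms unfolding bounded_op_def by blast

text \<open>Boundedness enters twice: it makes the generator everywhere defined, so that the
  first-order formula applies, and it removes the coefficient \<open>B\<close>. What remains
  multiplies second derivatives by a real-valued holomorphic function.\<close>

lemma bounded_group_generator_trivial:
  assumes T: "isometry_group T" and bounded: "bounded_op (group_generator T)"
  shows "\<exists>\<alpha>::real. group_generator T = trivial_op \<alpha>"
proof -
  have dom: "Domain (group_generator T) = little_zygmund00"
    using bounded by (simp add: bounded_op_def)
  obtain C where C: "\<And>f g. (f, g) \<in> group_generator T \<Longrightarrow> zygmund_norm g \<le> C * zygmund_norm f"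
    using bounded by (rule bounded_opE) (rule that, blast)
  have ex: "\<exists>g. (f, g) \<in> group_generator T" if "f \<in> little_zygmund00" for f
    using that dom by blast
  obtain A where A: "(disc_monomial 0, A) \<in> group_generator T"
    using ex[OF disc_monomial_in] by blast
  obtain E where E: "(disc_monomial 1, E) \<in> group_generator T"
    using ex[OF disc_monomial_in] by blast
  define B where "B z = (deriv ^^ 2) E z - z * (deriv ^^ 2) A z" for z
  have form: "(deriv ^^ 2) g z = (deriv ^^ 2) f z * (deriv ^^ 2) A z + (deriv ^^ 3) f z * B z"
    if "(f, g) \<in> group_generator T" "z \<in> ball 0 1" for f g z
    unfolding B_def by (rule group_generator_first_order[OF T dom A E that])
  note A_in = group_generator_in(2)[OF A] and E_in = group_generator_in(2)[OF E]
  have B0: "B z = 0" if "z \<in> ball 0 1" for z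
  proof (rule first_order_coefficient_eq_zero[OF A_in _ _ that])
    show "B holomorphic_on ball 0 1"
      unfolding B_def
      by (intro holomorphic_intros holomorphic_higher_deriv little_zygmund00_holomorphic A_in E_in open_ball)
    fix n and z :: complex assume z: "z \<in> ball 0 1"
    obtain g where g: "(disc_monomial (Suc n), g) \<in> group_generator T"
      using ex[OF disc_monomial_in] by blast
    have "zygmund_weight g z \<le> C * zygmund_norm (disc_monomial (Suc n))"
      using zygmund_weight_le_norm[OF group_generator_in(2)[OF g] z] C[OF g] by linarith
    \<comment> \<open>The sign of \<open>C\<close> is unknown, so monotonicity needs its absolute
      value.\<close>
    also have "\<dots> \<le> \<bar>C\<bar> * (2 / (real (Suc n) + 1))"
      using zygmund_norm_disc_monomial_le[of "Suc n"]
      by (intro mult_mono zygmund_norm_nonneg disc_monomial_in) auto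
    also have "\<dots> \<le> 2 * \<bar>C\<bar> / real (Suc n)"
      by (simp add: field_simps)
    finally show "(1 - (cmod z)\<^sup>2) * cmod (z ^ Suc n * (deriv ^^ 2) A z + of_nat (Suc n) * z ^ n * B z)
        \<le> 2 * \<bar>C\<bar> / real (Suc n)"
      by (simp only: zygmund_weight_def form[OF g z] deriv2_disc_monomial[OF z]
          deriv3_disc_monomial[OF z] diff_Suc_1)
  qed
  \<comment> \<open>With \<open>B\<close> gone, the peak function is multiplied at \<open>a\<close>
    by the second derivative of \<open>A\<close>. Its own second derivative is positive there, so
    reality passes to the factor.\<close>
  have "Im ((deriv ^^ 2) A a) = 0" if a: "a \<in> ball 0 1" for a
  proof -
    obtain p where p: "p \<in> little_zygmund00" "(deriv ^^ 2) p a = of_real (1 / (1 - (cmod a)\<^sup>2)\<^sup>2)"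
      "\<And>z. z \<in> ball 0 1 \<Longrightarrow> (1 - (cmod a)\<^sup>2) * zygmund_weight p z \<le> 1 - (cmod (z - a))\<^sup>2 / 4"
      using exists_peak_function[OF a] by blast
    obtain q where q: "(p, q) \<in> group_generator T"
      using ex[OF p(1)] by blast
    define v where "v = 1 - (cmod a)\<^sup>2"
    have v: "0 < v"
      using a by (simp add: v_def abs_square_less_1)
    have "zygmund_weight p z \<le> zygmund_weight p a" if "z \<in> ball 0 1" for z
    proof -
      have "v * zygmund_weight p z \<le> 1"
        using p(3)[OF that] unfolding v_def by (rule order_trans) simp
      also have "1 = v * zygmund_weight p a"
        unfolding zygmund_weight_def p(2) v_def[symmetric] using v
        by (simp add: norm_divide norm_mult power2_eq_square)
      finally show ?thesis
        using v by simp
    qed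
    then have "Im ((deriv ^^ 2) q a * cnj ((deriv ^^ 2) p a)) = 0"
      by (rule group_generator_real_at_peak[OF T q a])
    then show ?thesis
      unfolding form[OF q a] B0[OF a] p(2) v_def[symmetric] using v by simp
  qed
  then have "(deriv ^^ 2) A constant_on ball 0 1"
    by (intro holomorphic_real_valued_imp_constant holomorphic_higher_deriv
        little_zygmund00_holomorphic A_in open_ball connected_ball)
  then obtain c where c: "\<And>z. z \<in> ball 0 1 \<Longrightarrow> (deriv ^^ 2) A z = c"
    by (auto simp: constant_on_def)
  define \<alpha> where "\<alpha> = Re c"
  have c_eq: "c = of_real \<alpha>"
    using \<open>\<And>a. a \<in> ball 0 1 \<Longrightarrow> Im ((deriv ^^ 2) A a) = 0\<close>[of 0] c[of 0]
    by (simp add: \<alpha>_def complex_eq_iff)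
  have scalar: "g = (\<lambda>z. of_real \<alpha> * f z)" if fg: "(f, g) \<in> group_generator T" for f g
  proof -
    note in1 = group_generator_in[OF fg]
    let ?d = "\<lambda>z. 1 * g z + (- of_real \<alpha>) * f z"
    have "?d = (\<lambda>_. 0)"
    proof (rule little_zygmund00_eq_zero)
      show "?d \<in> little_zygmund00"
        by (rule little_zygmund00_lincomb[OF in1(2,1)])
      fix z :: complex assume z: "z \<in> ball 0 1"
      have "(deriv ^^ 2) ?d z = 1 * (deriv ^^ 2) g z + (- of_real \<alpha>) * (deriv ^^ 2) f z"
        by (rule higher_deriv_lincomb[OF little_zygmund00_holomorphic[OF in1(2)]
              little_zygmund00_holomorphic[OF in1(1)] open_ball z])
      then show "(deriv ^^ 2) ?d z = 0"
        by (simp add: form[OF fg z] B0[OF z] c[OF z] c_eq)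
    qed
    then show ?thesis
      by (simp add: fun_eq_iff)
  qed
  have "group_generator T = trivial_op \<alpha>"
  proof (rule set_eqI, clarify)
    fix f g
    show "(f, g) \<in> group_generator T \<longleftrightarrow> (f, g) \<in> trivial_op \<alpha>"
    proof
      assume "(f, g) \<in> group_generator T"
      then show "(f, g) \<in> trivial_op \<alpha>"
        using scalar group_generator_in(1) by (auto simp: trivial_op_def)
    next
      assume "(f, g) \<in> trivial_op \<alpha>"
      then have "f \<in> little_zygmund00" "g = (\<lambda>z. of_real \<alpha> * f z)"
        by (auto simp: trivial_op_def)
      then show "(f, g) \<in> group_generator T"
        \<comment> \<open>The full domain provides some image, and \<open>scalar\<close> identifies
          it with \<open>g\<close>.\<close>
        using ex[of f] scalar[of f] by metis
    qed
  qed
  then show ?thesis ..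
qed

section \<open>First-order differential operators\<close>

text \<open>The image would be \<open>\<alpha> * z^2 + 2 * z * p z\<close>, whose quotient by
  \<open>z\<close> tends to \<open>2 * p 0\<close>, against the vanishing derivative at 0 required
  in the space.\<close>

lemma disc_square_notin_Domain_diff_op:
  assumes "p 0 \<noteq> 0" "continuous_on (ball 0 1) p"
  shows "disc_square \<notin> Domain (diff_op \<alpha> p)"
proof
  assume "disc_square \<in> Domain (diff_op \<alpha> p)"
  then obtain g where g: "g \<in> little_zygmund00"
    "\<And>z. z \<in> ball 0 1 \<Longrightarrow> g z = of_real \<alpha> * disc_square z + p z * deriv disc_square z"
    by (auto simp: diff_op_def)
  have "(g has_field_derivative 0) (at 0)"
    using holomorphic_derivI[OF little_zygmund00_holomorphic[OF g(1)] open_ball, of 0]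
    by (simp add: little_zygmund00_deriv_0[OF g(1)])
  then have "((\<lambda>z. g z / z) \<longlongrightarrow> 0) (at 0)"
    by (simp add: has_field_derivative_iff little_zygmund00_0[OF g(1)])
  moreover have "((\<lambda>z. g z / z) \<longlongrightarrow> 2 * p 0) (at 0)"
  proof (rule Lim_transform_within_open)
    have "(p \<longlongrightarrow> p 0) (at 0)"
      using assms(2) by (simp add: continuous_on_def at_within_open[OF _ open_ball])
    then have "((\<lambda>z. of_real \<alpha> * z + p z * 2) \<longlongrightarrow> of_real \<alpha> * 0 + p 0 * 2) (at 0)"
      by (intro tendsto_intros)
    then show "((\<lambda>z. of_real \<alpha> * z + p z * 2) \<longlongrightarrow> 2 * p 0) (at 0)"
      by (simp add: mult.commute)
    show "of_real \<alpha> * z + p z * 2 = g z / z" if "z \<in> ball 0 1" "z \<noteq> 0" for z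
      unfolding g(2)[OF that(1)] deriv_disc_square[OF that(1)]
      using that by (simp add: disc_square_def power2_eq_square field_simps)
  qed auto
  ultimately have "0 = 2 * p 0"
    by (rule LIM_unique)
  then show False
    using assms(1) by simp
qed

text \<open>
  At a point where \<open>p\<close> does not vanish, \<open>p f'\<close> has a zero of lower order than \<open>f\<close>.
\<close>

lemma point_spectrum_diff_op_empty:
  assumes "p 0 \<noteq> 0" "continuous_on (ball 0 1) p"
  shows "point_spectrum (diff_op \<alpha> p) = {}"
proof (rule ccontr)
  assume "point_spectrum (diff_op \<alpha> p) \<noteq> {}"
  then obtain \<mu> f where "f \<noteq> (\<lambda>_. 0)" "(f, \<lambda>z. \<mu> * f z) \<in> diff_op \<alpha> p"
    by (auto simp: point_spectrum_def)
  then have f: "f \<noteq> (\<lambda>_. 0)" "f \<in> little_zygmund00"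
    "\<And>z. z \<in> ball 0 1 \<Longrightarrow> \<mu> * f z = of_real \<alpha> * f z + p z * deriv f z"
    by (auto simp: diff_op_def)
  have nc: "\<not> f constant_on ball 0 1"
  proof
    assume "f constant_on ball 0 1"
    then obtain c where c: "\<And>z. z \<in> ball 0 1 \<Longrightarrow> f z = c"
      by (auto simp: constant_on_def)
    then have "c = 0"
      using c[of 0] little_zygmund00_0[OF f(2)] by simp
    then show False
      using c little_zygmund00_outside[OF f(2)] f(1) by (metis ext)
  qed
  \<comment> \<open>\<open>n\<close> is the order of the zero of \<open>f\<close> at 0 and
    \<open>h\<close> the nonvanishing cofactor.\<close>
  obtain h r n where n: "0 < n" and r: "0 < r" "ball 0 r \<subseteq> ball (0::complex) 1"
    and h: "h holomorphic_on ball 0 r" "\<And>w. w \<in> ball 0 r \<Longrightarrow> f w = (w - 0) ^ n * h w"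
      "\<And>w. w \<in> ball 0 r \<Longrightarrow> h w \<noteq> 0"
    by (rule holomorphic_factor_zero_nonconstant[OF little_zygmund00_holomorphic[OF f(2)]
          open_ball connected_ball _ little_zygmund00_0[OF f(2)] nc])
       (simp, rule that, assumption+)
  have df: "deriv f w = w ^ (n - 1) * (of_nat n * h w + w * deriv h w)" if w: "w \<in> ball 0 r" for w
  proof (rule DERIV_imp_deriv)
    have wn: "w ^ n = w * w ^ (n - 1)"
      using power_minus_mult[OF n, of w] by (simp only: mult.commute)
    have "((\<lambda>w. w ^ n * h w) has_field_derivative
        of_nat n * w ^ (n - 1) * h w + w ^ n * deriv h w) (at w)"
      by (rule DERIV_cong[OF DERIV_mult[OF DERIV_power[OF DERIV_ident] holomorphic_derivI[OF h(1) open_ball w]]])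
         simp
    then show "(f has_field_derivative w ^ (n - 1) * (of_nat n * h w + w * deriv h w)) (at w)"
      by (rule has_field_derivative_transform_within_open[OF DERIV_cong open_ball w])
         (use h(2) in \<open>simp_all add: wn algebra_simps\<close>)
  qed
  \<comment> \<open>This is the eigenvalue equation divided by \<open>w ^ (n - 1)\<close>. The
    division is possible only for \<open>w \<noteq> 0\<close>; continuity carries the identity to 0,
    where only \<open>- p 0 * n * h 0\<close> survives.\<close>
  define \<phi> where "\<phi> w = (\<mu> - of_real \<alpha>) * w * h w - p w * (of_nat n * h w + w * deriv h w)" for w
  have \<phi>0: "\<phi> w = 0" if w: "w \<in> ball 0 r" "w \<noteq> 0" for w
  proof -
    have wn: "w ^ n = w * w ^ (n - 1)"
      using power_minus_mult[OF n, of w] by (simp only: mult.commute)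
    have "w ^ (n - 1) * \<phi> w = (\<mu> - of_real \<alpha>) * f w - p w * deriv f w"
      using w by (simp add: \<phi>_def df h(2) wn algebra_simps)
    also have "\<dots> = 0"
      using f(3)[of w] r(2) w by (auto simp: algebra_simps)
    finally show ?thesis
      using w by simp
  qed
  have "continuous_on (ball 0 r) \<phi>"
    unfolding \<phi>_def
    by (intro continuous_intros continuous_on_subset[OF assms(2) r(2)]
        holomorphic_on_imp_continuous_on h(1) holomorphic_deriv open_ball)
  then have "(\<phi> \<longlongrightarrow> \<phi> 0) (at 0)"
    using r(1) by (simp add: continuous_on_def at_within_open[OF _ open_ball])
  moreover have "(\<phi> \<longlongrightarrow> 0) (at 0)"
    by (rule Lim_transform_within_open[OF tendsto_const open_ball[of 0 r]]) (use r(1) \<phi>0 in auto)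
  ultimately have "\<phi> 0 = 0"
    by (rule LIM_unique)
  then show False
    using assms(1) n h(3)[of 0] r(1) by (simp add: \<phi>_def)
qed

text \<open>For \<open>\<tau> = 0\<close> the coefficient is \<open>c * z\<close>, so
  \<open>disc_monomial n\<close> is an eigenvector with eigenvalue
  \<open>\<alpha> + c * (n + 2)\<close>, which is unbounded in \<open>n\<close>.\<close>

lemma elliptic_op_0_not_bounded:
  assumes "c \<noteq> 0"
  shows "\<not> bounded_op (elliptic_op \<alpha> c 0)"
proof
  assume "bounded_op (elliptic_op \<alpha> c 0)"
  then obtain C where C: "\<And>f g. (f, g) \<in> elliptic_op \<alpha> c 0 \<Longrightarrow> zygmund_norm g \<le> C * zygmund_norm f"
    by (rule bounded_opE) (rule that, blast)
  have bound: "\<bar>\<alpha> + c * real (n + 2)\<bar> \<le> C" for n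
  proof -
    define \<mu> where "\<mu> = \<alpha> + c * real (n + 2)"
    let ?f = "disc_monomial n"
    \<comment> \<open>The zero summand gives the shape that the rules on linear combinations
      expect.\<close>
    let ?g = "\<lambda>z. of_real \<mu> * ?f z + 0 * ?f z"
    have g: "?g \<in> little_zygmund00"
      by (rule little_zygmund00_lincomb[OF disc_monomial_in disc_monomial_in])
    have nz: "of_nat (n + 1) \<noteq> (0::complex)" "of_nat (n + 2) \<noteq> (0::complex)"
      by (simp_all only: of_nat_eq_0_iff)
    have "?g z = of_real \<alpha> * ?f z + of_real c * z * deriv ?f z" if "z \<in> ball 0 1" for z
    proof -
      have "z * deriv ?f z = of_nat (n + 2) * ?f z"
        using that nz by (simp add: disc_monomial_def deriv_disc_monomial del: of_nat_add of_nat_Suc)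
      then have "of_real c * z * deriv ?f z = of_real c * (of_nat (n + 2) * ?f z)"
        by (simp only: mult.assoc)
      then show ?thesis
        by (simp add: \<mu>_def algebra_simps)
    qed
    then have "(?f, ?g) \<in> elliptic_op \<alpha> c 0"
      using g by (simp add: elliptic_op_def diff_op_def disc_monomial_in)
    note norm_g = C[OF this]
    have weight: "\<bar>\<mu>\<bar> * zygmund_weight ?f z \<le> C * zygmund_norm ?f" if z: "z \<in> ball 0 1" for z
    proof -
      have "(deriv ^^ 2) ?g z = of_real \<mu> * (deriv ^^ 2) ?f z"
        using higher_deriv_lincomb[OF little_zygmund00_holomorphic[OF disc_monomial_in]
            little_zygmund00_holomorphic[OF disc_monomial_in] open_ball z, of 2 "of_real \<mu>" n 0 n]
        by simp
      then have "\<bar>\<mu>\<bar> * zygmund_weight ?f z = zygmund_weight ?g z"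
        by (simp add: zygmund_weight_def norm_mult)
      then show ?thesis
        using zygmund_weight_le_norm[OF g z] norm_g by linarith
    qed
    have "0 < zygmund_weight ?f (1 / 2)"
      by (simp add: zygmund_weight_def deriv2_disc_monomial norm_divide norm_power power2_eq_square)
    then have pos: "0 < zygmund_norm ?f"
      using zygmund_weight_le_norm[OF disc_monomial_in, of "1 / 2" n] by (simp add: norm_divide)
    \<comment> \<open>The scaling is known for weights; passing to the supremum divides by
      \<open>|\<mu>|\<close>, hence the separate case.\<close>
    have "\<bar>\<mu>\<bar> \<le> C"
    proof (cases "\<mu> = 0")
      case True
      then have "0 \<le> C * zygmund_norm ?f"
        using weight[of 0] by simp
      then show ?thesis
        using pos True by (simp add: zero_le_mult_iff)
    next
      case False
      have "zygmund_norm ?f \<le> C * zygmund_norm ?f / \<bar>\<mu>\<bar>"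
        using weight False by (intro zygmund_norm_le[OF disc_monomial_in]) (simp add: field_simps)
      then have "\<bar>\<mu>\<bar> * zygmund_norm ?f \<le> C * zygmund_norm ?f"
        using False by (simp add: field_simps)
      then show ?thesis
        using pos by simp
    qed
    then show ?thesis
      by (simp only: \<mu>_def)
  qed
  obtain n :: nat where n: "(\<bar>C\<bar> + \<bar>\<alpha>\<bar>) / \<bar>c\<bar> < real n"
    using reals_Archimedean2 by blast
  then have "\<bar>C\<bar> + \<bar>\<alpha>\<bar> < \<bar>c\<bar> * real n"
    using assms by (simp add: field_simps)
  also have "\<dots> \<le> \<bar>c * real (n + 2)\<bar>"
    unfolding abs_mult by (intro mult_left_mono) auto
  finally show False
    using bound[of n] by linarith
qed

section \<open>The explicit forms\<close>

lemma point_spectrum_trivial_op: "point_spectrum (trivial_op \<alpha>) = {of_real \<alpha>}"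
proof (intro equalityI subsetI)
  fix \<mu> assume "\<mu> \<in> point_spectrum (trivial_op \<alpha>)"
  then obtain f where f: "f \<noteq> (\<lambda>_. 0)" "(f, \<lambda>z. \<mu> * f z) \<in> trivial_op \<alpha>"
    by (auto simp: point_spectrum_def)
  from f(2) have eq: "(\<lambda>z. \<mu> * f z) = (\<lambda>z. of_real \<alpha> * f z)"
    by (auto simp: trivial_op_def)
  obtain z where "f z \<noteq> 0"
    using f(1) by blast
  then show "\<mu> \<in> {of_real \<alpha>}"
    using fun_cong[OF eq, of z] by simp
next
  fix \<mu> :: complex assume "\<mu> \<in> {of_real \<alpha>}"
  moreover have "(disc_square, \<lambda>z. of_real \<alpha> * disc_square z) \<in> trivial_op \<alpha>"
    using mult_disc_square_in[of 1] by (simp add: trivial_op_def)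
  moreover have "disc_square (1 / 2) \<noteq> 0"
    by (simp add: disc_square_def norm_divide)
  then have "disc_square \<noteq> (\<lambda>_. 0)"
    unfolding fun_eq_iff by blast
  ultimately show "\<mu> \<in> point_spectrum (trivial_op \<alpha>)"
    unfolding point_spectrum_def by blast
qed

text \<open>The coefficient at 0 is \<open>- c * \<tau> / (1 - |\<tau>|^2)\<close>, nonzero since
  \<open>c\<close> and \<open>\<tau>\<close> are.\<close>

lemma elliptic_op_square_and_point_spectrum:
  assumes "c \<noteq> 0" "cmod \<tau> < 1" "\<tau> \<noteq> 0"
  shows "disc_square \<notin> Domain (elliptic_op \<alpha> c \<tau>)" "point_spectrum (elliptic_op \<alpha> c \<tau>) = {}"
proof -
  let ?p = "\<lambda>z. - (of_real c * ((cnj \<tau> * z - 1) * (z - \<tau>) / of_real (1 - (cmod \<tau>)\<^sup>2)))"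
  have "(cmod \<tau>)\<^sup>2 < 1"
    using assms(2) by (simp add: abs_square_less_1)
  then have nz: "(of_real (1 - (cmod \<tau>)\<^sup>2) :: complex) \<noteq> 0"
    by (simp only: of_real_eq_0_iff)
  then have p0: "?p 0 \<noteq> 0"
    using assms by (simp del: of_real_diff)
  have cont: "continuous_on (ball 0 1) ?p"
    by (intro continuous_intros) (use nz in simp)
  show "disc_square \<notin> Domain (elliptic_op \<alpha> c \<tau>)" "point_spectrum (elliptic_op \<alpha> c \<tau>) = {}"
    unfolding elliptic_op_def
    by (rule disc_square_notin_Domain_diff_op[OF p0 cont] point_spectrum_diff_op_empty[OF p0 cont])+
qed

text \<open>The coefficient at 0 is \<open>\<i> * \<phi> * \<beta>\<^sub>0 * \<beta>\<^sub>1 /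
  (\<beta>\<^sub>0 - \<beta>\<^sub>1)\<close>, and points of the circle are not 0.\<close>

lemma hyperbolic_op_square_and_point_spectrum:
  assumes "\<phi> > 0" "cmod \<beta>\<^sub>0 = 1" "cmod \<beta>\<^sub>1 = 1" "\<beta>\<^sub>0 \<noteq> \<beta>\<^sub>1"
  shows "disc_square \<notin> Domain (hyperbolic_op \<alpha> \<phi> \<beta>\<^sub>0 \<beta>\<^sub>1)"
    "point_spectrum (hyperbolic_op \<alpha> \<phi> \<beta>\<^sub>0 \<beta>\<^sub>1) = {}"
proof -
  let ?p = "\<lambda>z. \<i> * of_real \<phi> / (\<beta>\<^sub>0 - \<beta>\<^sub>1) * (z - \<beta>\<^sub>0) * (z - \<beta>\<^sub>1)"
  have "\<beta>\<^sub>0 \<noteq> 0" "\<beta>\<^sub>1 \<noteq> 0"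
    using assms(2,3) by auto
  then have p0: "?p 0 \<noteq> 0"
    using assms(1,4) by simp
  have cont: "continuous_on (ball 0 1) ?p"
    by (intro continuous_intros) (use assms(4) in simp)
  show "disc_square \<notin> Domain (hyperbolic_op \<alpha> \<phi> \<beta>\<^sub>0 \<beta>\<^sub>1)"
    "point_spectrum (hyperbolic_op \<alpha> \<phi> \<beta>\<^sub>0 \<beta>\<^sub>1) = {}"
    unfolding hyperbolic_op_def
    by (rule disc_square_notin_Domain_diff_op[OF p0 cont] point_spectrum_diff_op_empty[OF p0 cont])+
qed

text \<open>The coefficient at 0 is \<open>c * \<gamma>\<close>, because
  \<open>cnj \<gamma> * \<gamma> = 1\<close>.\<close>

lemma parabolic_op_square_and_point_spectrum:
  assumes "c \<noteq> 0" "cmod \<gamma> = 1"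
  shows "disc_square \<notin> Domain (parabolic_op \<alpha> c \<gamma>)" "point_spectrum (parabolic_op \<alpha> c \<gamma>) = {}"
proof -
  let ?p = "\<lambda>z. of_real c * cnj \<gamma> * (z - \<gamma>)\<^sup>2"
  have "\<gamma> \<noteq> 0"
    using assms(2) by auto
  then have p0: "?p 0 \<noteq> 0"
    using assms(1) by simp
  have cont: "continuous_on (ball 0 1) ?p"
    by (intro continuous_intros)
  show "disc_square \<notin> Domain (parabolic_op \<alpha> c \<gamma>)" "point_spectrum (parabolic_op \<alpha> c \<gamma>) = {}"
    unfolding parabolic_op_def
    by (rule disc_square_notin_Domain_diff_op[OF p0 cont] point_spectrum_diff_op_empty[OF p0 cont])+
qed

text \<open>A bounded operator is everywhere defined, so its domain contains
  \<open>disc_square\<close>. That excludes every nontrivial form but the elliptic one with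
  \<open>\<tau> = 0\<close>, which is unbounded.\<close>

lemma bounded_explicit_form_trivial:
  assumes "explicit_form G" "bounded_op G"
  shows "\<exists>\<alpha>::real. G = trivial_op \<alpha>"
proof -
  have sq: "disc_square \<in> Domain G"
    using assms(2) mult_disc_square_in[of 1] by (simp add: bounded_op_def)
  show ?thesis
    using assms(1) unfolding explicit_form_def
  proof (elim disjE exE conjE)
    fix \<alpha> c \<tau> assume "c \<noteq> 0" "cmod \<tau> < 1" "G = elliptic_op \<alpha> c \<tau>"
    then show ?thesis
      using sq assms(2) elliptic_op_square_and_point_spectrum(1)[of c \<tau> \<alpha>] elliptic_op_0_not_bounded[of c \<alpha>]
      by (cases "\<tau> = 0") simp_all
  next
    fix \<alpha> \<phi> \<beta>\<^sub>0 \<beta>\<^sub>1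
    assume "\<phi> > 0" "cmod \<beta>\<^sub>0 = 1" "cmod \<beta>\<^sub>1 = 1" "\<beta>\<^sub>0 \<noteq> \<beta>\<^sub>1" "G = hyperbolic_op \<alpha> \<phi> \<beta>\<^sub>0 \<beta>\<^sub>1"
    then show ?thesis
      using sq hyperbolic_op_square_and_point_spectrum(1)[of \<phi> \<beta>\<^sub>0 \<beta>\<^sub>1 \<alpha>] by simp
  next
    fix \<alpha> c \<gamma> assume "c \<noteq> 0" "cmod \<gamma> = 1" "G = parabolic_op \<alpha> c \<gamma>"
    then show ?thesis
      using sq parabolic_op_square_and_point_spectrum(1)[of c \<gamma> \<alpha>] by simp
  qed blast
qed

theorem mainTheorem4:
  shows
    "(\<forall>G. (hermitian_op G \<or> explicit_form G) \<and> bounded_op G \<longrightarrow> (\<exists>\<alpha>::real. G = trivial_op \<alpha>)) \<and>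
     (\<forall>(\<alpha>::real) (c::real) \<tau>. c \<noteq> 0 \<and> cmod \<tau> < 1 \<and> \<tau> \<noteq> 0 \<longrightarrow>
        disc_square \<notin> Domain (elliptic_op \<alpha> c \<tau>) \<and> point_spectrum (elliptic_op \<alpha> c \<tau>) = {}) \<and>
     (\<forall>(\<alpha>::real) (\<phi>::real) \<beta>\<^sub>0 \<beta>\<^sub>1. \<phi> > 0 \<and> cmod \<beta>\<^sub>0 = 1 \<and> cmod \<beta>\<^sub>1 = 1 \<and> \<beta>\<^sub>0 \<noteq> \<beta>\<^sub>1 \<longrightarrow>
        disc_square \<notin> Domain (hyperbolic_op \<alpha> \<phi> \<beta>\<^sub>0 \<beta>\<^sub>1) \<and>
        point_spectrum (hyperbolic_op \<alpha> \<phi> \<beta>\<^sub>0 \<beta>\<^sub>1) = {}) \<and>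
     (\<forall>(\<alpha>::real) (c::real) \<gamma>. c \<noteq> 0 \<and> cmod \<gamma> = 1 \<longrightarrow>
        disc_square \<notin> Domain (parabolic_op \<alpha> c \<gamma>) \<and> point_spectrum (parabolic_op \<alpha> c \<gamma>) = {}) \<and>
     (\<forall>\<alpha>::real. is_singleton (point_spectrum (trivial_op \<alpha>)))"
proof (intro conjI allI impI; (elim conjE)?)
  fix G assume "hermitian_op G \<or> explicit_form G" "bounded_op G"
  \<comment> \<open>The disjuncts are treated independently: generators by the peak argument,
    explicit forms through their domains and the monomials.\<close>
  then show "\<exists>\<alpha>::real. G = trivial_op \<alpha>"
    using bounded_group_generator_trivial bounded_explicit_form_trivial
    unfolding hermitian_op_def by blast
next
  fix \<alpha> :: real
  show "is_singleton (point_spectrum (trivial_op \<alpha>))"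
    by (simp add: point_spectrum_trivial_op)
qed (simp_all add: elliptic_op_square_and_point_spectrum hyperbolic_op_square_and_point_spectrum
    parabolic_op_square_and_point_spectrum)

end
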